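(* Let $v$ and $w$ be weights, and assume that for some constants $R>0$, $C>0$ and $0<\delta\le1$ the following hold for $w$ on the interval $]R,\infty[$: (i) $w$ is of class $C^2$; (ii) the function $r\mapsto|w'(r)|\,r^{1+\delta}$ is non-increasing; (iii) $-\frac{w(r)w''(r)}{w'(r)^2}\le C$. The following conditions are equivalent for an entire function $g\in H(\mathbb{C})$: (1) $V_g:H^\infty_v(\mathbb{C})\to H^\infty_w(\mathbb{C})$ is compact. (2) $V_g:H^0_v(\mathbb{C})\to H^0_w(\mathbb{C})$ is compact. (3) $\lim_{|z|\to\infty}\frac{w(z)^2|g'(z)|}{w'(z)\,\tilde v(z)}=0$. If, moreover, every discrete sequence in $\mathbb{C}$ has a subsequence that is interpolating for $H^\infty_{\tilde v}(\mathbb{C})$, then these three conditions are also equivalent to (4) $V_g:H^\infty_v(\mathbb{C})\to H^\infty_w(\mathbb{C})$ is weakly compact. (5) $V_g:H^0_v(\mathbb{C})\to H^0_w(\mathbb{C})$ is weakly compact.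
   Context: $H(\mathbb{C})$ is the space of entire functions. A weight is a continuous non-increasing function $v:[0,\infty[\to]0,\infty[$ with $\lim_{r\to\infty}r^mv(r)=0$ for each $m\in\mathbb{N}$; it is extended to $\mathbb{C}$ by $v(z):=v(|z|)$. For a weight $w$, $w'$ and $w''$ denote the derivatives with respect to $r\in[0,\infty[$, and $w'(z):=w'(|z|)$. For a weight $v$, $H^\infty_v(\mathbb{C})=\{f\in H(\mathbb{C}):\|f\|_v:=\sup_{z\in\mathbb{C}}v(|z|)|f(z)|<\infty\}$ and $H^0_v(\mathbb{C})=\{f\in H(\mathbb{C}):\lim_{|z|\to\infty}v(|z|)|f(z)|=0\}$, both endowed with the norm $\|\cdot\|_v$ (they are Banach spaces). The associated weight is $\tilde v(z):=\big(\sup\{|f(z)|:f\in H^\infty_v(\mathbb{C}),\ \|f\|_v\le1\}\big)^{-1}$, $z\in\mathbb{C}$; it is again a (radial) weight. For $g\in H(\mathbb{C})$, $g'$ is the complex derivative and the Volterra operator is $V_g(f)(z):=\int_0^zf(\zeta)g'(\zeta)\,d\zeta$, $f\in H(\mathbb{C})$, $z\in\mathbb{C}$. Saying that an operator $T:X\to Y$ between two such spaces is compact (weakly compact) means that $T$ maps $X$ into $Y$ and is a bounded operator mapping the unit ball of $X$ to a relatively compact (relatively weakly compact) subset of $Y$. A sequence $(z_j)_j$ in $\mathbb{C}$ is called interpolating for $H^\infty_u(\mathbb{C})$ ($u$ a weight) if for every sequence $(\alpha_j)_j$ of complex numbers with $\sup_{j}u(z_j)|\alpha_j|<\infty$ there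 is $f\in H^\infty_u(\mathbb{C})$ with $f(z_j)=\alpha_j$ for each $j$. A discrete sequence in $\mathbb{C}$ is a sequence $(z_j)_j$ with $|z_j|\to\infty$ (no accumulation point in $\mathbb{C}$). *)

theory Defs
  imports "HOL-Complex_Analysis.Complex_Analysis"
begin

section \<open>Weights and weighted spaces of entire functions\<close>

text \<open>Only the values on \<open>[0,\<infinity>[\<close> of a weight matter.\<close>

definition is_weight :: "(real \<Rightarrow> real) \<Rightarrow> bool" where
  "is_weight v \<longleftrightarrow>
     continuous_on {0..} v \<and> antimono_on {0..} v \<and> (\<forall>r\<ge>0. v r > 0) \<and>
     (\<forall>m::nat. ((\<lambda>r. r ^ m * v r) \<longlongrightarrow> 0) at_top)"

definition radial :: "(real \<Rightarrow> real) \<Rightarrow> complex \<Rightarrow> real" where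
  "radial v = (\<lambda>z. v (cmod z))"

text \<open>The spaces are indexed by a weight function on \<open>\<complex>\<close>, so that the associated weight can be
  used as an index as well.  The supremum \<open>wnorm u f\<close> is meaningful only for \<open>f \<in> Hinf u\<close>.\<close>

definition Hinf :: "(complex \<Rightarrow> real) \<Rightarrow> (complex \<Rightarrow> complex) set" where
  "Hinf u = {f. f holomorphic_on UNIV \<and> bdd_above (range (\<lambda>z. u z * cmod (f z)))}"

definition H0 :: "(complex \<Rightarrow> real) \<Rightarrow> (complex \<Rightarrow> complex) set" where
  "H0 u = {f. f holomorphic_on UNIV \<and> ((\<lambda>z. u z * cmod (f z)) \<longlongrightarrow> 0) at_infinity}"

definition wnorm :: "(complex \<Rightarrow> real) \<Rightarrow> (complex \<Rightarrow> complex) \<Rightarrow> real" where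
  "wnorm u f = (SUP z. u z * cmod (f z))"

definition assoc_weight :: "(complex \<Rightarrow> real) \<Rightarrow> complex \<Rightarrow> real" where
  "assoc_weight u z = inverse (SUP f\<in>{f \<in> Hinf u. wnorm u f \<le> 1}. cmod (f z))"

definition interpolating :: "(complex \<Rightarrow> real) \<Rightarrow> (nat \<Rightarrow> complex) \<Rightarrow> bool" where
  "interpolating u z \<longleftrightarrow>
     (\<forall>\<alpha> :: nat \<Rightarrow> complex. bdd_above (range (\<lambda>j. u (z j) * cmod (\<alpha> j))) \<longrightarrow>
        (\<exists>f \<in> Hinf u. \<forall>j. f (z j) = \<alpha> j))"

definition discrete_seq :: "(nat \<Rightarrow> complex) \<Rightarrow> bool" where
  "discrete_seq z \<longleftrightarrow> filterlim z at_infinity sequentially"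

definition volterra :: "(complex \<Rightarrow> complex) \<Rightarrow> (complex \<Rightarrow> complex) \<Rightarrow> complex \<Rightarrow> complex" where
  "volterra g f z = contour_integral (linepath 0 z) (\<lambda>\<zeta>. f \<zeta> * deriv g \<zeta>)"


section \<open>Compact and weakly compact operators\<close>

text \<open>A normed space of complex-valued functions is given by its carrier \<open>X\<close> and its norm \<open>N\<close>,
  with pointwise operations.  The distance is set to \<open>0\<close> off the carrier because
  \<open>Metric_space\<close> requires nonnegativity everywhere.\<close>

definition norm_dist ::
  "('a \<Rightarrow> complex) set \<Rightarrow> (('a \<Rightarrow> complex) \<Rightarrow> real) \<Rightarrow> ('a \<Rightarrow> complex) \<Rightarrow> ('a \<Rightarrow> complex) \<Rightarrow> real" where
  "norm_dist X N f h = (if f \<in> X \<and> h \<in> X then N (\<lambda>z. f z - h z) else 0)"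

definition norm_topology ::
  "('a \<Rightarrow> complex) set \<Rightarrow> (('a \<Rightarrow> complex) \<Rightarrow> real) \<Rightarrow> ('a \<Rightarrow> complex) topology" where
  "norm_topology X N = Metric_space.mtopology X (norm_dist X N)"

definition dual ::
  "('a \<Rightarrow> complex) set \<Rightarrow> (('a \<Rightarrow> complex) \<Rightarrow> real) \<Rightarrow> (('a \<Rightarrow> complex) \<Rightarrow> complex) set" where
  "dual X N = {\<phi>.
     (\<forall>f\<in>X. \<forall>h\<in>X. \<phi> (\<lambda>z. f z + h z) = \<phi> f + \<phi> h) \<and>
     (\<forall>c. \<forall>f\<in>X. \<phi> (\<lambda>z. c * f z) = c * \<phi> f) \<and>
     (\<exists>K. \<forall>f\<in>X. cmod (\<phi> f) \<le> K * N f)}"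

definition weak_topology ::
  "('a \<Rightarrow> complex) set \<Rightarrow> (('a \<Rightarrow> complex) \<Rightarrow> real) \<Rightarrow> ('a \<Rightarrow> complex) topology" where
  "weak_topology X N =
     topology_generated_by {{f \<in> X. \<phi> f \<in> U} | \<phi> U. \<phi> \<in> dual X N \<and> open U}"

definition relatively_compactin :: "'a topology \<Rightarrow> 'a set \<Rightarrow> bool" where
  "relatively_compactin T S \<longleftrightarrow> S \<subseteq> topspace T \<and> compactin T (T closure_of S)"

definition bounded_op ::
  "(('a \<Rightarrow> complex) \<Rightarrow> ('b \<Rightarrow> complex)) \<Rightarrow> ('a \<Rightarrow> complex) set \<Rightarrow> (('a \<Rightarrow> complex) \<Rightarrow> real) \<Rightarrow>
   ('b \<Rightarrow> complex) set \<Rightarrow> (('b \<Rightarrow> complex) \<Rightarrow> real) \<Rightarrow> bool" where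
  "bounded_op T X N Y M \<longleftrightarrow>
     T ` X \<subseteq> Y \<and>
     (\<forall>f\<in>X. \<forall>h\<in>X. T (\<lambda>z. f z + h z) = (\<lambda>z. T f z + T h z)) \<and>
     (\<forall>c. \<forall>f\<in>X. T (\<lambda>z. c * f z) = (\<lambda>z. c * T f z)) \<and>
     (\<exists>K. \<forall>f\<in>X. M (T f) \<le> K * N f)"

definition compact_op ::
  "(('a \<Rightarrow> complex) \<Rightarrow> ('b \<Rightarrow> complex)) \<Rightarrow> ('a \<Rightarrow> complex) set \<Rightarrow> (('a \<Rightarrow> complex) \<Rightarrow> real) \<Rightarrow>
   ('b \<Rightarrow> complex) set \<Rightarrow> (('b \<Rightarrow> complex) \<Rightarrow> real) \<Rightarrow> bool" where
  "compact_op T X N Y M \<longleftrightarrow>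
     bounded_op T X N Y M \<and>
     relatively_compactin (norm_topology Y M) (T ` {f \<in> X. N f \<le> 1})"

definition weakly_compact_op ::
  "(('a \<Rightarrow> complex) \<Rightarrow> ('b \<Rightarrow> complex)) \<Rightarrow> ('a \<Rightarrow> complex) set \<Rightarrow> (('a \<Rightarrow> complex) \<Rightarrow> real) \<Rightarrow>
   ('b \<Rightarrow> complex) set \<Rightarrow> (('b \<Rightarrow> complex) \<Rightarrow> real) \<Rightarrow> bool" where
  "weakly_compact_op T X N Y M \<longleftrightarrow>
     bounded_op T X N Y M \<and>
     relatively_compactin (weak_topology Y M) (T ` {f \<in> X. N f \<le> 1})"


section \<open>The topologies are well defined\<close>

lemma Metric_space_norm_dist:
  assumes minus: "\<And>f h. f \<in> X \<Longrightarrow> h \<in> X \<Longrightarrow> (\<lambda>z. f z - h z) \<in> X"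
    and nonneg: "\<And>f. f \<in> X \<Longrightarrow> 0 \<le> N f"
    and definite: "\<And>f. f \<in> X \<Longrightarrow> N f = 0 \<longleftrightarrow> f = (\<lambda>z. 0)"
    and sym: "\<And>f. f \<in> X \<Longrightarrow> N (\<lambda>z. - f z) = N f"
    and triangle: "\<And>f h. f \<in> X \<Longrightarrow> h \<in> X \<Longrightarrow> N (\<lambda>z. f z + h z) \<le> N f + N h"
  shows "Metric_space X (norm_dist X N)"
proof
  show "0 \<le> norm_dist X N f h" for f h
    using minus nonneg by (simp add: norm_dist_def)
  show "norm_dist X N f h = norm_dist X N h f" for f h
    using sym[OF minus[of f h]] by (simp add: norm_dist_def)
  show "norm_dist X N f h = 0 \<longleftrightarrow> f = h" if "f \<in> X" "h \<in> X" for f h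
    using that definite[OF minus[of f h]] by (simp add: norm_dist_def fun_eq_iff)
  show "norm_dist X N f k \<le> norm_dist X N f h + norm_dist X N h k"
    if "f \<in> X" "h \<in> X" "k \<in> X" for f h k
    using that triangle[OF minus[of f h] minus[of h k]] by (simp add: norm_dist_def)
qed

lemma Hinf_diff:
  assumes "\<And>z. 0 < u z" "f \<in> Hinf u" "h \<in> Hinf u"
  shows "(\<lambda>z. f z - h z) \<in> Hinf u"
proof -
  obtain A B where AB: "\<And>z. u z * cmod (f z) \<le> A" "\<And>z. u z * cmod (h z) \<le> B"
    using assms by (auto simp: Hinf_def bdd_above_def)
  have "u z * cmod (f z - h z) \<le> A + B" for z
  proof -
    have "u z * cmod (f z - h z) \<le> u z * (cmod (f z) + cmod (h z))"
      using assms(1)[of z] norm_triangle_ineq4[of "f z" "h z"] by (intro mult_left_mono) auto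
    also have "\<dots> \<le> A + B" using AB[of z] by (simp add: algebra_simps)
    finally show ?thesis .
  qed
  then have "bdd_above (range (\<lambda>z. u z * cmod (f z - h z)))"
    by (auto simp: bdd_above_def)
  then show ?thesis
    using assms by (auto simp: Hinf_def intro!: holomorphic_intros)
qed

lemma wnorm_ge:
  assumes "f \<in> Hinf u" shows "u z * cmod (f z) \<le> wnorm u f"
  using assms unfolding wnorm_def Hinf_def by (intro cSUP_upper) auto

lemma Metric_space_weighted:
  assumes pos: "\<And>z. 0 < u z" and sub: "X \<subseteq> Hinf u"
    and minus: "\<And>f h. f \<in> X \<Longrightarrow> h \<in> X \<Longrightarrow> (\<lambda>z. f z - h z) \<in> X"
  shows "Metric_space X (norm_dist X (wnorm u))"
proof (rule Metric_space_norm_dist)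
  show "(\<lambda>z. f z - h z) \<in> X" if "f \<in> X" "h \<in> X" for f h
    using minus that by blast
  show "0 \<le> wnorm u f" if "f \<in> X" for f
  proof -
    have "0 \<le> u 0 * cmod (f 0)" using pos[of 0] by simp
    also have "\<dots> \<le> wnorm u f" using wnorm_ge[of f u 0] that sub by blast
    finally show ?thesis .
  qed
  show "wnorm u f = 0 \<longleftrightarrow> f = (\<lambda>z. 0)" if "f \<in> X" for f
  proof
    assume "wnorm u f = 0"
    then have "u z * cmod (f z) \<le> 0" for z
      using wnorm_ge[of f u z] that sub by auto
    then have "cmod (f z) \<le> 0" for z
      using pos[of z] by (meson mult_pos_pos not_le)
    then show "f = (\<lambda>z. 0)" by auto
  qed (simp add: wnorm_def)
  show "wnorm u (\<lambda>z. - f z) = wnorm u f" for f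
    by (simp add: wnorm_def)
  show "wnorm u (\<lambda>z. f z + h z) \<le> wnorm u f + wnorm u h" if "f \<in> X" "h \<in> X" for f h
    unfolding wnorm_def[of u "\<lambda>z. f z + h z"]
  proof (rule cSUP_least)
    fix z
    have "u z * cmod (f z + h z) \<le> u z * (cmod (f z) + cmod (h z))"
      using pos[of z] norm_triangle_ineq[of "f z" "h z"] by (intro mult_left_mono) auto
    also have "\<dots> \<le> wnorm u f + wnorm u h"
      using wnorm_ge[of f u z] wnorm_ge[of h u z] that sub
      by (simp add: subset_iff distrib_left)
    finally show "u z * cmod (f z + h z) \<le> wnorm u f + wnorm u h" .
  qed simp
qed

lemma Metric_space_Hinf:
  assumes "\<And>z. 0 < u z"
  shows "Metric_space (Hinf u) (norm_dist (Hinf u) (wnorm u))"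
  by (rule Metric_space_weighted) (auto intro: assms Hinf_diff)

lemma radial_pos: "is_weight v \<Longrightarrow> 0 < radial v z"
  by (simp add: is_weight_def radial_def)

lemma H0_subset_Hinf:
  assumes "is_weight v"
  shows "H0 (radial v) \<subseteq> Hinf (radial v)"
proof
  fix f assume f: "f \<in> H0 (radial v)"
  let ?F = "\<lambda>z. radial v z * cmod (f z)"
  have hol: "f holomorphic_on UNIV" and lim: "(?F \<longlongrightarrow> 0) at_infinity"
    using f by (auto simp: H0_def)
  have "eventually (\<lambda>z. ?F z < 1) at_infinity"
    using order_tendstoD(2)[OF lim, of 1] by simp
  then obtain b where b: "\<And>z. b \<le> cmod z \<Longrightarrow> ?F z < 1"
    by (auto simp: eventually_at_infinity)
  have "continuous_on (cball 0 b) (\<lambda>z. v (cmod z))"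
    using assms by (auto simp: is_weight_def
        intro!: continuous_on_compose2[of "{0..}" v _ cmod] continuous_intros)
  moreover have "continuous_on (cball 0 b) f"
    using holomorphic_on_imp_continuous_on[OF hol] continuous_on_subset by blast
  ultimately have "continuous_on (cball 0 b) ?F"
    by (auto simp: radial_def intro!: continuous_intros)
  then have "bounded (?F ` cball 0 b)"
    by (intro compact_imp_bounded compact_continuous_image) auto
  then obtain B where B: "\<And>z. z \<in> cball 0 b \<Longrightarrow> norm (?F z) \<le> B"
    unfolding bounded_iff by blast
  have "?F z \<le> max 1 B" for z
  proof (cases "b \<le> cmod z")
    case True
    then show ?thesis using b[of z] by simp
  next
    case False
    then have "norm (?F z) \<le> B" by (intro B) simp
    then show ?thesis by simp
  qed
  then have "bdd_above (range ?F)"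
    by (auto simp: bdd_above_def)
  with hol show "f \<in> Hinf (radial v)"
    by (simp add: Hinf_def)
qed

lemma H0_diff:
  assumes pos: "\<And>z. 0 < u z" and f: "f \<in> H0 u" and h: "h \<in> H0 u"
  shows "(\<lambda>z. f z - h z) \<in> H0 u"
proof -
  have "((\<lambda>z. u z * cmod (f z) + u z * cmod (h z)) \<longlongrightarrow> 0) at_infinity"
    using tendsto_add[of "\<lambda>z. u z * cmod (f z)" 0 at_infinity "\<lambda>z. u z * cmod (h z)" 0] f h
    by (simp add: H0_def)
  moreover have "norm (u z * cmod (f z - h z)) \<le> u z * cmod (f z) + u z * cmod (h z)" for z
  proof -
    have "u z * cmod (f z - h z) \<le> u z * (cmod (f z) + cmod (h z))"
      using pos[of z] norm_triangle_ineq4[of "f z" "h z"] by (intro mult_left_mono) auto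
    then show ?thesis using pos[of z] by (simp add: algebra_simps abs_mult)
  qed
  ultimately have "((\<lambda>z. u z * cmod (f z - h z)) \<longlongrightarrow> 0) at_infinity"
    by (intro Lim_null_comparison[of "\<lambda>z. u z * cmod (f z - h z)"]) auto
  then show ?thesis
    using f h by (auto simp: H0_def intro!: holomorphic_intros)
qed

lemma Metric_space_H0:
  assumes "is_weight v"
  shows "Metric_space (H0 (radial v)) (norm_dist (H0 (radial v)) (wnorm (radial v)))"
  using assms H0_subset_Hinf
  by (intro Metric_space_weighted) (auto intro: radial_pos H0_diff)

lemma topspace_weak_topology [simp]: "topspace (weak_topology X N) = X"
proof -
  have "(\<lambda>f. 0) \<in> dual X N"
    by (auto simp: dual_def intro!: exI[of _ 0])
  then have "X \<in> {{f \<in> X. \<phi> f \<in> U} | \<phi> U. \<phi> \<in> dual X N \<and> open U}"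
    by (auto intro!: exI[of _ "\<lambda>f. 0"] exI[of _ UNIV])
  then show ?thesis
    unfolding weak_topology_def topology_generated_by_topspace by blast
qed

end

theory Submission
  imports Defs
begin

text \<open>
  Put \<open>u = 1/w\<close>.  Its derivative \<open>u' = |w'|/w\<^sup>2\<close>, called \<open>slope\<close> below, governs the derivatives of the
  functions of the target space: for an entire function \<open>F\<close>, the estimates \<open>F = O(u)\<close> and
  \<open>F' = O(u')\<close> at infinity are equivalent, and likewise with \<open>o\<close> in place of \<open>O\<close>.  One direction is
  integration along rays (\<open>integrate_slope_bound\<close>, \<open>slope_imp_H0\<close>).  The other one is Cauchy's
  estimate on discs of radius comparable to \<open>q = w/|w'|\<close> (\<open>deriv_le_wnorm\<close>, \<open>deriv_H0\<close>): the bound on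
  \<open>- w w''/w'\<^sup>2\<close> says that \<open>q' \<ge> - (1 + C)\<close>, so \<open>q\<close> cannot drop quickly and \<open>w\<close>, whose logarithmic
  derivative is \<open>- 1/q\<close>, loses only a bounded factor over such a radius (\<open>weight_step\<close>).  As
  \<open>(V\<^sub>g f)' = f g'\<close> and \<open>1/|f|\<close> is at least the associated weight for \<open>f\<close> in the unit ball, the
  third condition says exactly that \<open>(V\<^sub>g f)' = o(u')\<close> uniformly on the unit ball of the domain.

  If it holds, Montel's theorem and the integration estimate show that the image of the unit ball of
  the large domain space is norm compact, and that it lies in the small target space
  (\<open>compactin_volterra_ball\<close>).  Since the weak topology is coarser and Hausdorff, all four
  compactness statements follow.

  Conversely, suppose that it fails along a sequence \<open>y\<^sub>j\<close>.  Polynomials are used as test functions.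
  They belong to both domain spaces, they approximate the unit ball of the large one
  (\<open>polynomial_approximation\<close>), and their images lie in the small target space as soon as they lie in
  the large one (\<open>polynomial_volterra_H0\<close>).  Hence the small and the large spaces can be treated
  simultaneously.
  If the operator is compact, choose polynomials almost extremal at \<open>y\<^sub>j\<close>.  A subsequence of
  their images is Cauchy, and the derivative of each fixed image is \<open>o(u')\<close>; so the derivatives of the
  images at \<open>y\<^sub>j\<close> cannot all be comparable to \<open>u'\<close>.
  If it is weakly compact, interpolation along a subsequence yields a single \<open>f\<close> for which
  \<open>|(V\<^sub>g f)'| \<ge> \<eta> u'\<close> at all \<open>y\<^sub>j\<close>.  Approximating \<open>f\<close> by a bounded sequence of
  polynomials \<open>p\<^sub>N\<close>, weak compactness makes \<open>V\<^sub>g f\<close> a weak cluster point of the \<open>V\<^sub>g p\<^sub>N\<close>.  But the limit of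
  \<open>F'(y\<^sub>j)/u'(|y\<^sub>j|)\<close> along a free ultrafilter is a bounded functional that vanishes on the small
  target space, hence at every \<open>V\<^sub>g p\<^sub>N\<close>, and not at \<open>V\<^sub>g f\<close> (\<open>exists_limit_functional\<close>).
\<close>

section \<open>Weighted norms and the associated weight\<close>

lemma
  assumes "f holomorphic_on UNIV" "\<And>z. u z * cmod (f z) \<le> B"
  shows Hinf_boundI: "f \<in> Hinf u" and wnorm_le: "wnorm u f \<le> B"
  using assms unfolding Hinf_def wnorm_def
  by (auto simp: bdd_above_def intro: cSUP_least)

lemma wnorm_nonneg:
  assumes "\<And>z. 0 < u z" "f \<in> Hinf u"
  shows "0 \<le> wnorm u f"
proof -
  have "0 \<le> u 0 * cmod (f 0)" using assms(1)[of 0] by simp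
  then show ?thesis using wnorm_ge[OF assms(2), of 0] by linarith
qed

lemma cmod_le_wnorm_divide:
  assumes "\<And>z. 0 < u z" "f \<in> Hinf u"
  shows "cmod (f z) \<le> wnorm u f / u z"
  using wnorm_ge[OF assms(2), of z] assms(1)[of z] by (simp add: field_simps)

lemma
  assumes "\<And>z. 0 < u z" "f \<in> Hinf u"
  shows Hinf_cmult: "(\<lambda>z. c * f z) \<in> Hinf u"
    and wnorm_cmult_le: "wnorm u (\<lambda>z. c * f z) \<le> cmod c * wnorm u f"
proof -
  have b: "u z * cmod (c * f z) \<le> cmod c * wnorm u f" for z
    using mult_left_mono[OF wnorm_ge[OF assms(2), of z], of "cmod c"]
    by (simp add: norm_mult mult_ac)
  have "(\<lambda>z. c * f z) holomorphic_on UNIV"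
    using assms(2) by (auto simp: Hinf_def intro!: holomorphic_intros)
  with b show "(\<lambda>z. c * f z) \<in> Hinf u" "wnorm u (\<lambda>z. c * f z) \<le> cmod c * wnorm u f"
    by (auto intro: Hinf_boundI wnorm_le)
qed

lemma weight_antimono: "is_weight v \<Longrightarrow> 0 \<le> r \<Longrightarrow> r \<le> s \<Longrightarrow> v s \<le> v r"
  by (auto simp: is_weight_def monotone_on_def)

lemma weight_tendsto_0: "is_weight v \<Longrightarrow> (v \<longlongrightarrow> 0) at_top"
  unfolding is_weight_def by (auto dest: spec[of _ 0])

lemma polynomial_holomorphic: "(\<lambda>z. \<Sum>k<n. a k * z ^ k :: complex) holomorphic_on UNIV"
  by (intro holomorphic_intros)

text \<open>Weights decay faster than every power.\<close>

lemma polynomial_in_H0: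
  assumes "is_weight v"
  shows "(\<lambda>z. \<Sum>k<n. a k * z ^ k) \<in> H0 (radial v)"
proof -
  have "((\<lambda>z. radial v z * cmod (\<Sum>k<n. a k * z ^ k)) \<longlongrightarrow> 0) at_infinity"
  proof (rule Lim_null_comparison)
    show "\<forall>\<^sub>F z in at_infinity. norm (radial v z * cmod (\<Sum>k<n. a k * z ^ k))
        \<le> (\<Sum>k<n. cmod (a k) * (cmod z ^ k * v (cmod z)))"
    proof (intro always_eventually allI)
      fix z
      have "cmod (\<Sum>k<n. a k * z ^ k) \<le> (\<Sum>k<n. cmod (a k) * cmod z ^ k)"
        by (rule order_trans[OF norm_sum]) (simp add: norm_mult norm_power)
      then have "radial v z * cmod (\<Sum>k<n. a k * z ^ k)
          \<le> radial v z * (\<Sum>k<n. cmod (a k) * cmod z ^ k)"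
        using radial_pos[OF assms, of z] by (intro mult_left_mono) auto
      then show "norm (radial v z * cmod (\<Sum>k<n. a k * z ^ k))
          \<le> (\<Sum>k<n. cmod (a k) * (cmod z ^ k * v (cmod z)))"
        using radial_pos[OF assms, of z]
        by (simp add: abs_mult sum_distrib_left radial_def mult_ac)
    qed
    have "((\<lambda>z::complex. cmod z ^ k * v (cmod z)) \<longlongrightarrow> 0) at_infinity" for k
    proof -
      have "((\<lambda>r. r ^ k * v r) \<longlongrightarrow> 0) at_top"
        using assms by (simp add: is_weight_def)
      from filterlim_compose[OF this filterlim_norm_at_top] show ?thesis .
    qed
    then have "((\<lambda>z::complex. \<Sum>k<n. cmod (a k) * (cmod z ^ k * v (cmod z))) \<longlongrightarrow> (\<Sum>k<n. cmod (a k) * 0))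
      at_infinity"
      by (intro tendsto_sum tendsto_mult tendsto_const)
    then show "((\<lambda>z::complex. \<Sum>k<n. cmod (a k) * (cmod z ^ k * v (cmod z))) \<longlongrightarrow> 0) at_infinity"
      by simp
  qed
  then show ?thesis
    by (simp add: H0_def polynomial_holomorphic)
qed

lemma radial_le_0: "is_weight v \<Longrightarrow> radial v z \<le> v 0"
  by (simp add: radial_def weight_antimono)

lemma weight_0_pos: "is_weight v \<Longrightarrow> 0 < v 0"
  by (simp add: is_weight_def)

text \<open>The supremum defining the associated weight is finite because \<open>|f| \<le> 1/v\<close> on the unit ball, and
  positive because the constant \<open>1/v(0)\<close> belongs to the unit ball.  The factor \<open>2\<close> in the last claim
  leaves room, as the supremum need not be attained.\<close>

lemma
  assumes v: "is_weight v"
  shows assoc_weight_pos: "0 < assoc_weight (radial v) z"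
    and assoc_weight_ge: "radial v z \<le> assoc_weight (radial v) z"
    and Hinf_cmod_le_assoc: "f \<in> Hinf (radial v) \<Longrightarrow> cmod (f z) * assoc_weight (radial v) z \<le> wnorm (radial v) f"
    and assoc_weight_witness: "\<exists>f \<in> Hinf (radial v). wnorm (radial v) f \<le> 1 \<and> 1 \<le> 2 * assoc_weight (radial v) z * cmod (f z)"
proof -
  define B where "B = {f \<in> Hinf (radial v). wnorm (radial v) f \<le> 1}"
  define S where "S = (SUP f\<in>B. cmod (f z))"
  have aw: "assoc_weight (radial v) z = inverse S"
    by (simp add: assoc_weight_def S_def B_def)
  have le: "cmod (f z) \<le> 1 / radial v z" if "f \<in> B" for f
  proof -
    have "radial v z * cmod (f z) \<le> 1" using that wnorm_ge[of f "radial v" z] by (auto simp: B_def)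
    then show ?thesis using radial_pos[OF v, of z] by (simp add: field_simps)
  qed
  have bdd: "bdd_above ((\<lambda>f. cmod (f z)) ` B)"
    using le by (auto simp: bdd_above_def)
  have const: "(\<lambda>_. 1 / of_real (v 0)) \<in> B"
  proof -
    have "radial v \<zeta> * cmod (1 / of_real (v 0)) \<le> 1" for \<zeta>
      using weight_0_pos[OF v] radial_le_0[OF v, of \<zeta>] by (simp add: norm_divide field_simps)
    then show ?thesis
      using Hinf_boundI[of "\<lambda>_. 1 / of_real (v 0)" "radial v" 1] wnorm_le[of "\<lambda>_. 1 / of_real (v 0)" "radial v" 1]
      by (simp add: B_def)
  qed
  have S_ge: "cmod (f z) \<le> S" if "f \<in> B" for f
    unfolding S_def using bdd that by (intro cSUP_upper)
  have S_pos: "0 < S"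
    using S_ge[OF const] weight_0_pos[OF v] by (simp add: norm_divide) (smt (verit) divide_pos_pos)
  have S_le: "S \<le> 1 / radial v z"
    unfolding S_def using const le by (intro cSUP_least) auto
  show "0 < assoc_weight (radial v) z" using S_pos by (simp add: aw)
  show "radial v z \<le> assoc_weight (radial v) z"
    using S_pos S_le radial_pos[OF v, of z] by (simp add: aw field_simps)
  show "cmod (f z) * assoc_weight (radial v) z \<le> wnorm (radial v) f" if f: "f \<in> Hinf (radial v)"
  proof (cases "wnorm (radial v) f = 0")
    case True
    then have "cmod (f z) \<le> 0" using cmod_le_wnorm_divide[OF radial_pos[OF v] f, of z] by simp
    then show ?thesis using True by simp
  next
    case False
    then have pos: "0 < wnorm (radial v) f" using wnorm_nonneg[OF radial_pos[OF v] f] by simp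
    have "(\<lambda>z. of_real (1 / wnorm (radial v) f) * f z) \<in> B"
      using Hinf_cmult[OF radial_pos[OF v] f, of "of_real (1 / wnorm (radial v) f)"]
        wnorm_cmult_le[OF radial_pos[OF v] f, of "of_real (1 / wnorm (radial v) f)"] pos
      by (simp add: B_def norm_divide)
    from S_ge[OF this] show ?thesis
      using pos S_pos by (simp add: aw norm_divide field_simps)
  qed
  have "\<exists>f\<in>B. S / 2 < cmod (f z)"
    using less_cSUP_iff[of B "\<lambda>f. cmod (f z)" "S / 2"] const bdd S_pos
    by (auto simp: S_def)
  then show "\<exists>f \<in> Hinf (radial v). wnorm (radial v) f \<le> 1 \<and> 1 \<le> 2 * assoc_weight (radial v) z * cmod (f z)"
    using S_pos by (auto simp: B_def aw field_simps intro: less_imp_le)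
qed

section \<open>Approximation by polynomials\<close>

text \<open>Cauchy's inequality on the circle through \<open>z\<close>, on which the radial weight is constant.\<close>

lemma taylor_term_le:
  assumes v: "is_weight v" and f: "f \<in> Hinf (radial v)"
  shows "cmod ((deriv ^^ k) f 0 / fact k * z ^ k) \<le> wnorm (radial v) f / radial v z"
proof (cases "z = 0")
  case True
  have "0 \<le> wnorm (radial v) f / radial v z"
    using wnorm_nonneg[OF radial_pos[OF v] f] radial_pos[OF v, of z] by simp
  then show ?thesis
    using cmod_le_wnorm_divide[OF radial_pos[OF v] f, of z] True by (cases k) auto
next
  case False
  have hol: "f holomorphic_on UNIV" using f by (simp add: Hinf_def)
  have "norm ((deriv ^^ k) f 0) \<le> fact k * (wnorm (radial v) f / radial v z) / cmod z ^ k"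
  proof (rule Cauchy_inequality)
    show "f holomorphic_on ball 0 (cmod z)" "continuous_on (cball 0 (cmod z)) f"
      using holomorphic_on_imp_continuous_on[OF holomorphic_on_subset[OF hol]]
        holomorphic_on_subset[OF hol] by auto
    show "0 < cmod z" using False by simp
    show "norm (f x) \<le> wnorm (radial v) f / radial v z" if "norm (0 - x) = cmod z" for x
      using cmod_le_wnorm_divide[OF radial_pos[OF v] f, of x] that by (simp add: radial_def)
  qed
  then show ?thesis
    using False mult_left_mono[of "norm ((deriv ^^ k) f 0)"
        "fact k * (wnorm (radial v) f / radial v z) / cmod z ^ k" "cmod z ^ k / fact k"]
    by (simp add: norm_mult norm_divide norm_power mult.commute)
qed

text \<open>The Taylor polynomials of \<open>f\<close> itself need not be bounded in norm.  Those of a dilation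
  \<open>z \<mapsto> f (t z)\<close> with \<open>t < 1\<close> are: by \<open>taylor_term_le\<close>, the remainder of order \<open>n\<close> is at most
  \<open>t\<^sup>n/(1 - t) \<parallel>f\<parallel>/v\<close> on the whole plane, and the dilation has norm at most \<open>\<parallel>f\<parallel>\<close> since \<open>v\<close> is
  non-increasing.\<close>

lemma polynomial_approximation:
  assumes v: "is_weight v" and f: "f \<in> Hinf (radial v)" and "0 < \<epsilon>" "0 \<le> A"
  obtains n a where
    "\<And>z. radial v z * cmod (\<Sum>k<n. a k * z ^ k) \<le> 2 * wnorm (radial v) f"
    "\<And>z. cmod z \<le> A \<Longrightarrow> cmod ((\<Sum>k<n. a k * z ^ k) - f z) \<le> \<epsilon>"
proof -
  let ?N = "wnorm (radial v) f"
  note pos = radial_pos[OF v]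
  have hol: "f holomorphic_on UNIV" using f by (simp add: Hinf_def)
  have N0: "0 \<le> ?N" using wnorm_nonneg[OF pos f] .
  have "uniformly_continuous_on (cball 0 A) f"
    using holomorphic_on_imp_continuous_on[OF holomorphic_on_subset[OF hol]]
    by (intro compact_uniformly_continuous) auto
  then obtain d where d: "0 < d"
    "\<And>x y. x \<in> cball 0 A \<Longrightarrow> y \<in> cball 0 A \<Longrightarrow> dist x y < d \<Longrightarrow> dist (f x) (f y) < \<epsilon> / 2"
    unfolding uniformly_continuous_on_def using \<open>0 < \<epsilon>\<close> by (meson half_gt_zero)
  \<comment> \<open>dilating by \<open>1 - s\<close> moves the points of the disc of radius \<open>A\<close> by less than \<open>d\<close>\<close>
  define s where "s = min (1/2) (d / (A + 1))"
  define t where "t = 1 - s"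
  have s: "0 < s" "s \<le> 1/2" "s * A < d"
  proof -
    show "0 < s" using d(1) \<open>0 \<le> A\<close> by (simp add: s_def)
    show "s \<le> 1/2" unfolding s_def by (rule min.cobounded1)
    from \<open>0 < s\<close> have "s * A < s * (A + 1)" by simp
    also have "\<dots> \<le> d / (A + 1) * (A + 1)"
      using \<open>0 \<le> A\<close> by (intro mult_right_mono) (auto simp: s_def)
    finally show "s * A < d" using \<open>0 \<le> A\<close> by simp
  qed
  then have t: "0 < t" "t < 1" by (auto simp: t_def)
  have "(\<lambda>n. t ^ n * (1 / (1 - t))) \<longlonglongrightarrow> 0 * (1 / (1 - t))"
    using t by (intro tendsto_mult LIMSEQ_power_zero tendsto_const) auto
  then have "(\<lambda>n. t ^ n / (1 - t)) \<longlonglongrightarrow> 0" by simp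
  \<comment> \<open>the bound \<open>1\<close> limits the norm to \<open>2 \<parallel>f\<parallel>\<close>, the other one makes the remainder at most \<open>\<epsilon>/2\<close> on the disc\<close>
  moreover define \<eta> where "\<eta> = min 1 (\<epsilon> / 2 * v A / (?N + 1))"
  moreover have "0 < \<eta>"
    using \<open>0 < \<epsilon>\<close> N0 v \<open>0 \<le> A\<close> by (auto simp: \<eta>_def is_weight_def)
  ultimately have "\<forall>\<^sub>F n in sequentially. t ^ n / (1 - t) < \<eta>"
    by (intro order_tendstoD(2))
  then obtain n where n: "t ^ n / (1 - t) < \<eta>"
    by (auto simp: eventually_sequentially)
  define c where "c k = (deriv ^^ k) f 0 / fact k" for k
  let ?p = "\<lambda>z. \<Sum>k<n. (c k * of_real t ^ k) * z ^ k"
  have tail: "cmod (f (of_real t * z) - ?p z) \<le> t ^ n / (1 - t) * (?N / radial v z)" for z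
  proof -
    have "(\<lambda>k. c k * (of_real t * z) ^ k) sums f (of_real t * z)"
      using holomorphic_power_series[of f 0 "cmod (of_real t * z) + 1" "of_real t * z"]
        holomorphic_on_subset[OF hol] by (simp add: c_def)
    from sums_split_initial_segment[OF this, of n]
    have sums: "(\<lambda>k. c (k + n) * (of_real t * z) ^ (k + n)) sums (f (of_real t * z) - ?p z)"
      by (simp add: power_mult_distrib mult.assoc)
    have gsums: "(\<lambda>k. t ^ k * (t ^ n * (?N / radial v z))) sums
        (1 / (1 - t) * (t ^ n * (?N / radial v z)))"
      using t by (intro sums_mult2 geometric_sums) auto
    have "cmod (c (k + n) * (of_real t * z) ^ (k + n)) \<le> t ^ k * (t ^ n * (?N / radial v z))" for k
      using mult_left_mono[OF taylor_term_le[OF v f, of "k + n" z], of "t ^ (k + n)"] t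
      by (simp add: c_def norm_mult norm_power power_mult_distrib power_add mult_ac norm_divide)
    from norm_sums_le[OF sums gsums this] show ?thesis by (simp add: mult_ac)
  qed
  show thesis
  proof (rule that[where n = n and a = "\<lambda>k. c k * of_real t ^ k"])
    fix z
    have dil: "radial v z * cmod (f (of_real t * z)) \<le> ?N"
    proof -
      have "radial v z \<le> radial v (of_real t * z)"
        using weight_antimono[OF v, of "t * cmod z" "cmod z"] t
        by (simp add: radial_def norm_mult mult_left_le_one_le)
      then have "radial v z * cmod (f (of_real t * z))
          \<le> radial v (of_real t * z) * cmod (f (of_real t * z))"
        by (intro mult_right_mono) auto
      also have "\<dots> \<le> ?N" by (rule wnorm_ge[OF f])
      finally show ?thesis .
    qed
    have "radial v z * cmod (?p z)
        \<le> radial v z * (cmod (f (of_real t * z)) + cmod (f (of_real t * z) - ?p z))"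
      using pos[of z] norm_triangle_ineq4[of "f (of_real t * z)" "f (of_real t * z) - ?p z"]
      by (intro mult_left_mono) auto
    also have "\<dots> \<le> ?N + radial v z * (t ^ n / (1 - t) * (?N / radial v z))"
      unfolding distrib_left using dil tail[of z] pos[of z]
      by (intro add_mono mult_left_mono) auto
    also have "\<dots> = ?N + t ^ n / (1 - t) * ?N" using pos[of z] by simp
    also have "\<dots> \<le> ?N + 1 * ?N"
      using n N0 by (intro add_left_mono mult_right_mono) (auto simp: \<eta>_def)
    finally show "radial v z * cmod (?p z) \<le> 2 * ?N" by simp
  next
    fix z assume z: "cmod z \<le> A"
    have "t * cmod z \<le> A"
      using t z mult_left_le_one_le[of "cmod z" t] by simp
    moreover have "cmod (of_real t * z - z) = s * cmod z"
    proof -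
      have "of_real t * z - z = of_real (- s) * z" by (simp add: t_def algebra_simps)
      then show ?thesis using s(1) by (simp only: norm_mult norm_of_real)
    qed
    moreover have "s * cmod z < d"
      by (rule order.strict_trans1[OF mult_left_mono s(3)]) (use s z in auto)
    ultimately have 1: "cmod (f (of_real t * z) - f z) < \<epsilon> / 2"
      using d(2)[of "of_real t * z" z] z s t by (auto simp: norm_mult dist_norm)
    have vA: "v A \<le> radial v z" using weight_antimono[OF v, of "cmod z" A] z by (simp add: radial_def)
    have vA0: "0 < v A" using v \<open>0 \<le> A\<close> by (simp add: is_weight_def)
    have "cmod (f (of_real t * z) - ?p z) \<le> t ^ n / (1 - t) * (?N / radial v z)" by (rule tail)
    also have "\<dots> \<le> (\<epsilon> / 2 * v A / (?N + 1)) * ((?N + 1) / v A)"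
    proof (rule mult_mono)
      show "t ^ n / (1 - t) \<le> \<epsilon> / 2 * v A / (?N + 1)" using n by (simp add: \<eta>_def)
      show "?N / radial v z \<le> (?N + 1) / v A" using N0 vA vA0 by (intro frac_le) auto
      show "0 \<le> \<epsilon> / 2 * v A / (?N + 1)" "0 \<le> ?N / radial v z"
        using N0 vA0 \<open>0 < \<epsilon>\<close> pos[of z] by auto
    qed
    also have "\<dots> = \<epsilon> / 2" using N0 vA0 nonzero_mult_divide_mult_cancel_right
      by (simp add: add_nonneg_eq_0_iff divide_simps)
    finally have 2: "cmod (?p z - f (of_real t * z)) \<le> \<epsilon> / 2"
      by (simp add: norm_minus_commute)
    have "?p z - f z = (?p z - f (of_real t * z)) + (f (of_real t * z) - f z)" by simp
    then show "cmod (?p z - f z) \<le> \<epsilon>"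
      using 1 2 norm_triangle_ineq[of "?p z - f (of_real t * z)" "f (of_real t * z) - f z"] by simp
  qed
qed

text \<open>An almost extremal function for the associated weight, replaced by a polynomial that is close to it
  at \<open>z\<close> and halved to return to the unit ball.\<close>

lemma polynomial_witness:
  assumes v: "is_weight v"
  obtains n a where "wnorm (radial v) (\<lambda>z. \<Sum>k<n. a k * z ^ k) \<le> 1"
    "1 \<le> 8 * assoc_weight (radial v) z * cmod (\<Sum>k<n. a k * z ^ k)"
proof -
  obtain f where f: "f \<in> Hinf (radial v)" "wnorm (radial v) f \<le> 1"
    "1 \<le> 2 * assoc_weight (radial v) z * cmod (f z)"
    using assoc_weight_witness[OF v, of z] by blast
  then have fz: "0 < cmod (f z)" by (cases "f z = 0") auto
  obtain n a where p: "\<And>z. radial v z * cmod (\<Sum>k<n. a k * z ^ k) \<le> 2 * wnorm (radial v) f"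
    "\<And>\<zeta>. cmod \<zeta> \<le> cmod z \<Longrightarrow> cmod ((\<Sum>k<n. a k * \<zeta> ^ k) - f \<zeta>) \<le> cmod (f z) / 2"
    by (rule polynomial_approximation[OF v f(1) half_gt_zero[OF fz] norm_ge_zero[of z]]) (rule that)
  let ?p = "\<lambda>z. \<Sum>k<n. a k * z ^ k" let ?q = "\<lambda>z. \<Sum>k<n. (a k / 2) * z ^ k"
  have q: "?q \<zeta> = ?p \<zeta> / 2" for \<zeta> by (simp add: sum_divide_distrib)
  show thesis
  proof (rule that[where n = n and a = "\<lambda>k. a k / 2"])
    show "wnorm (radial v) ?q \<le> 1"
    proof (rule wnorm_le[OF polynomial_holomorphic])
      fix \<zeta> show "radial v \<zeta> * cmod (?q \<zeta>) \<le> 1"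
        unfolding q using p(1)[of \<zeta>] f(2) by (simp add: norm_divide)
    qed
    have "cmod (f z) / 2 \<le> cmod (?p z)"
      using p(2)[of z] norm_triangle_ineq2[of "f z" "f z - ?p z"] by (simp add: norm_minus_commute)
    then have "2 * assoc_weight (radial v) z * cmod (f z)
        \<le> 2 * assoc_weight (radial v) z * (2 * cmod (?p z))"
      using assoc_weight_pos[OF v, of z] by (intro mult_left_mono) auto
    with f(3) show "1 \<le> 8 * assoc_weight (radial v) z * cmod (?q z)"
      unfolding q by (simp add: norm_divide mult_ac)
  qed
qed

section \<open>Derivatives and weights\<close>

text \<open>Where \<open>w'\<close> vanishes, monotonicity of \<open>|w'| r\<^sup>\<alpha>\<close> makes it vanish from there on, so that \<open>w\<close> would be
  eventually constant; this contradicts \<open>w \<rightarrow> 0\<close> and \<open>w > 0\<close>.\<close>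

lemma weight_deriv_neg:
  assumes w: "is_weight w" and "0 < R"
    and der: "\<And>r. R < r \<Longrightarrow> (w has_real_derivative deriv w r) (at r)"
    and anti: "antimono_on {R<..} (\<lambda>r. \<bar>deriv w r\<bar> * r powr \<alpha>)" and r: "R < r"
  shows "deriv w r < 0"
proof (rule ccontr)
  assume "\<not> deriv w r < 0"
  then consider "0 < deriv w r" | "deriv w r = 0" by linarith
  then show False
  proof cases
    case 1
    from DERIV_pos_inc_right[OF der[OF r] this]
    obtain d where d: "0 < d" "\<And>h. 0 < h \<Longrightarrow> h < d \<Longrightarrow> w r < w (r + h)" by blast
    have "w r < w (r + d / 2)" using d by simp
    then show False using weight_antimono[OF w, of r "r + d / 2"] d(1) r \<open>0 < R\<close> by simp
  next
    case 2
    have const: "w s = w r" if "r < s" for s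
    proof (rule DERIV_isconst_end[OF that])
      show "continuous_on {r..s} w"
        using w r \<open>0 < R\<close> by (auto simp: is_weight_def intro: continuous_on_subset)
      fix x assume x: "r < x" "x < s"
      then have "\<bar>deriv w x\<bar> * x powr \<alpha> \<le> \<bar>deriv w r\<bar> * r powr \<alpha>"
        using monotone_onD[OF anti, of r x] r by simp
      then have "deriv w x = 0"
        using 2 x r \<open>0 < R\<close> by (simp add: mult_le_0_iff)
      then show "(w has_real_derivative 0) (at x)" using der[of x] x r by simp
    qed
    have "(w \<longlongrightarrow> w r) at_top"
      by (rule tendsto_eventually[OF eventually_mono[OF eventually_gt_at_top const]])
    with weight_tendsto_0[OF w] have "w r = 0"
      by (metis tendsto_unique trivial_limit_at_top_linorder)
    then show False using w r \<open>0 < R\<close> by (auto simp: is_weight_def dest: spec[of _ r])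
  qed
qed

locale regular_weight =
  fixes w :: "real \<Rightarrow> real" and R C :: real
  assumes weight: "is_weight w" and R_pos: "0 < R" and C_pos: "0 < C"
    and deriv: "R < r \<Longrightarrow> (w has_real_derivative deriv w r) (at r)"
    and deriv_deriv: "R < r \<Longrightarrow> (deriv w has_real_derivative deriv (deriv w) r) (at r)"
    and deriv_neg: "R < r \<Longrightarrow> deriv w r < 0"
    and log_growth: "R < r \<Longrightarrow> - (w r * deriv (deriv w) r / (deriv w r)\<^sup>2) \<le> C"
begin

lemma pos: "0 \<le> r \<Longrightarrow> 0 < w r"
  using weight by (simp add: is_weight_def)

text \<open>The derivative of \<open>1/w\<close>.\<close>

definition slope :: "real \<Rightarrow> real" where
  "slope r = - deriv w r / (w r)\<^sup>2"

lemma slope_pos: "R < r \<Longrightarrow> 0 < slope r"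
  using deriv_neg[of r] pos[of r] R_pos by (simp add: slope_def divide_neg_pos)

lemma inverse_weight_deriv: "R < r \<Longrightarrow> ((\<lambda>r. 1 / w r) has_real_derivative slope r) (at r)"
  using deriv[of r] pos[of r] R_pos
  by (auto intro!: derivative_eq_intros simp: slope_def power2_eq_square)

text \<open>A radius on which \<open>w\<close> loses at most the factor \<open>e\<close>; see \<open>weight_step\<close>.\<close>

definition step :: "real \<Rightarrow> real" where
  "step r = - w r / deriv w r / (2 * (1 + C))"

lemma step_pos:
  assumes "R < r"
  shows "0 < step r"
proof -
  have "0 < - w r / deriv w r"
    using deriv_neg[OF assms] pos[of r] assms R_pos by (intro divide_neg_neg) auto
  then show ?thesis
    unfolding step_def by (rule divide_pos_pos) (use C_pos in simp)
qed

text \<open>With \<open>q = - w/w'\<close>, the growth condition reads \<open>q' \<ge> - (1 + C)\<close>.  Hence \<open>q \<ge> q(r)/2\<close> on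
  \<open>[r, r + step r]\<close>, and the logarithmic derivative \<open>- 1/q\<close> of \<open>w\<close> is at least \<open>- 2/q(r)\<close> there, so that
  \<open>ln w\<close> drops by at most \<open>2 step r/q(r) \<le> 1\<close>.\<close>

lemma weight_step:
  assumes r: "R < r"
  shows "w r \<le> exp 1 * w (r + step r)"
proof -
  define q where "q s = - w s / deriv w s" for s
  have q_pos: "0 < q s" if "R < s" for s
    using that deriv_neg[of s] pos[of s] R_pos by (simp add: q_def divide_pos_neg)
  have st: "step r = q r / (2 * (1 + C))" by (simp add: step_def q_def)
  have q_lower: "q r / 2 \<le> q s" if s: "r \<le> s" "s \<le> r + step r" for s
  proof -
    have "(\<lambda>x. q x + (1 + C) * x) r \<le> (\<lambda>x. q x + (1 + C) * x) s"
    proof (rule DERIV_nonneg_imp_nondecreasing[OF s(1)])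
      fix x assume x: "r \<le> x" "x \<le> s"
      then have "R < x" using r by simp
      have "(q has_real_derivative - 1 + w x * deriv (deriv w) x / (deriv w x)\<^sup>2) (at x)"
        unfolding q_def using deriv[OF \<open>R < x\<close>] deriv_deriv[OF \<open>R < x\<close>] deriv_neg[OF \<open>R < x\<close>]
        by (auto intro!: derivative_eq_intros simp: field_simps power2_eq_square)
      then have "((\<lambda>x. q x + (1 + C) * x) has_real_derivative
          - 1 + w x * deriv (deriv w) x / (deriv w x)\<^sup>2 + (1 + C)) (at x)"
        by (auto intro!: derivative_eq_intros)
      moreover have "0 \<le> - 1 + w x * deriv (deriv w) x / (deriv w x)\<^sup>2 + (1 + C)"
        using log_growth[OF \<open>R < x\<close>] by simp
      ultimately show "\<exists>y. ((\<lambda>x. q x + (1 + C) * x) has_real_derivative y) (at x) \<and> 0 \<le> y"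
        by blast
    qed
    then have "q r - (1 + C) * (s - r) \<le> q s" by (simp add: algebra_simps)
    moreover have "(1 + C) * (s - r) \<le> (1 + C) * step r"
      using s C_pos by (intro mult_left_mono) auto
    moreover have "(1 + C) * step r = q r / 2" using C_pos by (simp add: st field_simps)
    ultimately show ?thesis by simp
  qed
  have "(\<lambda>x. ln (w x) + 2 / q r * x) r \<le> (\<lambda>x. ln (w x) + 2 / q r * x) (r + step r)"
  proof (rule DERIV_nonneg_imp_nondecreasing[where f = "\<lambda>x. ln (w x) + 2 / q r * x"])
    show "r \<le> r + step r" using step_pos[OF r] by simp
    fix x assume x: "r \<le> x" "x \<le> r + step r"
    then have "R < x" "0 < w x" using r R_pos pos[of x] by auto
    have "((\<lambda>x. ln (w x) + 2 / q r * x) has_real_derivative deriv w x / w x + 2 / q r) (at x)"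
      using deriv[OF \<open>R < x\<close>] \<open>0 < w x\<close> q_pos[OF r] by (auto intro!: derivative_eq_intros)
    moreover have "1 / q x \<le> 1 / (q r / 2)"
      using q_lower[OF x] q_pos[OF r] by (intro divide_left_mono) auto
    then have "0 \<le> deriv w x / w x + 2 / q r" by (simp add: q_def mult.commute)
    ultimately show "\<exists>y. ((\<lambda>x. ln (w x) + 2 / q r * x) has_real_derivative y) (at x) \<and> 0 \<le> y"
      by blast
  qed
  then have "ln (w r) + 2 / q r * r \<le> ln (w (r + step r)) + (2 / q r * r + 2 / q r * step r)"
    by (simp only: distrib_left)
  then have "ln (w r) \<le> ln (w (r + step r)) + 2 / q r * step r" by linarith
  also have "2 / q r * step r = 1 / (1 + C)" using q_pos[OF r] C_pos by (simp add: st field_simps)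
  also have "1 / (1 + C) \<le> 1" using C_pos by simp
  finally have "ln (w r) \<le> ln (exp 1 * w (r + step r))"
    using pos[of "r + step r"] step_pos[OF r] r R_pos by (simp add: ln_mult)
  then show ?thesis
    using pos[of r] pos[of "r + step r"] step_pos[OF r] r R_pos by simp
qed

text \<open>Cauchy's estimate on the disc of radius \<open>step |z|\<close>.  By \<open>weight_step\<close>, the bound \<open>B/w\<close> at the outer
  radius exceeds \<open>B/w(|z|)\<close> by a factor of at most \<open>e\<close>, and \<open>1/step\<close> supplies the missing factor \<open>|w'|/w\<close>.\<close>

lemma deriv_le_slope:
  assumes F: "F holomorphic_on UNIV" and r: "R < cmod z"
    and bound: "\<And>\<zeta>. cmod \<zeta> \<le> cmod z + step (cmod z) \<Longrightarrow>
        cmod (F \<zeta>) \<le> B / w (cmod z + step (cmod z))"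
  shows "cmod (deriv F z) \<le> 2 * (1 + C) * exp 1 * B * slope (cmod z)"
proof -
  let ?r = "cmod z" let ?s = "step (cmod z)"
  note s = step_pos[OF r]
  have w: "0 < w ?r" "0 < w (?r + ?s)" using pos s r R_pos by auto
  have "0 \<le> B / w (?r + ?s)" using order_trans[OF norm_ge_zero bound[of 0]] s by simp
  then have B: "0 \<le> B" using w by (simp add: zero_le_divide_iff)
  have "cmod ((deriv ^^ 1) F z) \<le> fact 1 * (B / w (?r + ?s)) / ?s ^ 1"
  proof (rule Cauchy_inequality)
    show "F holomorphic_on ball z ?s" "continuous_on (cball z ?s) F"
      using holomorphic_on_imp_continuous_on[OF holomorphic_on_subset[OF F]]
        holomorphic_on_subset[OF F] by auto
    show "0 < ?s" by (rule s)
    fix x assume "norm (z - x) = ?s"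
    then have "cmod x \<le> ?r + ?s"
      using norm_triangle_ineq4[of z "z - x"] by simp
    then show "norm (F x) \<le> B / w (?r + ?s)" by (rule bound)
  qed
  also have "fact 1 * (B / w (?r + ?s)) / ?s ^ 1 = B / w (?r + ?s) / ?s" by simp
  also have "\<dots> \<le> (B * exp 1 / w ?r) / ?s"
  proof (intro divide_right_mono)
    have "1 / w (?r + ?s) \<le> exp 1 / w ?r" using weight_step[OF r] w by (simp add: field_simps)
    from mult_left_mono[OF this B] show "B / w (?r + ?s) \<le> B * exp 1 / w ?r" by simp
  qed (use s in simp)
  also have "\<dots> = 2 * (1 + C) * exp 1 * B * slope ?r"
    using w deriv_neg[OF r] C_pos by (simp add: step_def slope_def field_simps power2_eq_square)
  finally show ?thesis by simp
qed

lemma deriv_le_wnorm: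
  assumes F: "F \<in> Hinf (radial w)" and r: "R < cmod z"
  shows "cmod (deriv F z) \<le> 2 * (1 + C) * exp 1 * wnorm (radial w) F * slope (cmod z)"
proof (rule deriv_le_slope[OF _ r])
  show "F holomorphic_on UNIV" using F by (simp add: Hinf_def)
  fix \<zeta> assume \<zeta>: "cmod \<zeta> \<le> cmod z + step (cmod z)"
  have "cmod (F \<zeta>) \<le> wnorm (radial w) F / radial w \<zeta>"
    by (rule cmod_le_wnorm_divide[OF radial_pos[OF weight] F])
  also have "\<dots> \<le> wnorm (radial w) F / w (cmod z + step (cmod z))"
    using weight_antimono[OF weight, of "cmod \<zeta>"] \<zeta> pos[of "cmod z + step (cmod z)"]
      step_pos[OF r] wnorm_nonneg[OF radial_pos[OF weight] F]
    by (intro divide_left_mono) (auto simp: radial_def pos)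
  finally show "cmod (F \<zeta>) \<le> wnorm (radial w) F / w (cmod z + step (cmod z))" .
qed

text \<open>The bound required by \<open>deriv_le_slope\<close> concerns a full disc around the origin.  Far from the origin it
  holds with small \<open>B\<close> because \<open>w F\<close> is small; near the origin \<open>F\<close> is bounded, while \<open>1/w\<close> at
  the outer radius tends to infinity.\<close>

lemma deriv_H0:
  assumes F: "F \<in> H0 (radial w)" and "0 < \<epsilon>"
  shows "\<forall>\<^sub>F z in at_infinity. cmod (deriv F z) \<le> \<epsilon> * slope (cmod z)"
proof -
  define e where "e = \<epsilon> / (2 * (1 + C) * exp 1)"
  have e: "0 < e" using \<open>0 < \<epsilon>\<close> C_pos by (simp add: e_def)
  have hol: "F holomorphic_on UNIV" using F by (simp add: H0_def)
  have "\<forall>\<^sub>F z in at_infinity. radial w z * cmod (F z) < e"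
    using F e by (auto simp: H0_def intro: order_tendstoD(2))
  then obtain A where A: "\<And>z. A \<le> cmod z \<Longrightarrow> radial w z * cmod (F z) < e"
    by (auto simp: eventually_at_infinity)
  have "compact (F ` cball 0 A)"
    using holomorphic_on_imp_continuous_on[OF holomorphic_on_subset[OF hol]]
    by (intro compact_continuous_image) auto
  then obtain B where B: "0 < B" "\<And>z. cmod z \<le> A \<Longrightarrow> cmod (F z) \<le> B"
    by (auto dest!: compact_imp_bounded simp: bounded_pos)
  have "\<forall>\<^sub>F r in at_top. w r < e / B"
    using weight_tendsto_0[OF weight] e B by (auto intro: order_tendstoD(2))
  then have "\<forall>\<^sub>F r in at_top. w r < e / B \<and> R < r"
    by (intro eventually_conj eventually_gt_at_top)
  then have "\<forall>\<^sub>F z::complex in at_infinity. w (cmod z) < e / B \<and> R < cmod z"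
    using eventually_compose_filterlim[OF _ filterlim_norm_at_top] by blast
  then show ?thesis
  proof eventually_elim
    case (elim z)
    let ?s = "cmod z + step (cmod z)"
    have s: "0 < step (cmod z)" using step_pos elim by simp
    have ws: "0 < w ?s" "w ?s \<le> w (cmod z)"
      using pos[of ?s] weight_antimono[OF weight, of "cmod z" ?s] s by auto
    have "cmod (deriv F z) \<le> 2 * (1 + C) * exp 1 * e * slope (cmod z)"
    proof (rule deriv_le_slope[OF hol])
      show "R < cmod z" using elim by simp
      fix \<zeta> assume \<zeta>: "cmod \<zeta> \<le> ?s"
      show "cmod (F \<zeta>) \<le> e / w ?s"
      proof (cases "A \<le> cmod \<zeta>")
        case True
        have "w ?s * cmod (F \<zeta>) \<le> radial w \<zeta> * cmod (F \<zeta>)"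
          using weight_antimono[OF weight _ \<zeta>] by (intro mult_right_mono) (auto simp: radial_def)
        with A[OF True] ws show ?thesis by (simp add: field_simps)
      next
        case False
        have "w ?s \<le> e / B" using ws elim by simp
        then have "B \<le> e / w ?s" using ws B e by (simp add: field_simps)
        with B(2)[of \<zeta>] False show ?thesis by simp
      qed
    qed
    then show ?case using C_pos by (simp add: e_def)
  qed
qed

text \<open>Along each ray the function \<open>M/w\<close> has derivative \<open>M slope\<close>, which dominates that of \<open>F\<close>.  Having \<open>B\<close>
  and \<open>M\<close> separate matters: for large \<open>A\<close> the constant \<open>M\<close> can be chosen small, and the
  contribution of \<open>B\<close> disappears at infinity or under locally uniform convergence.\<close>

lemma integrate_slope_bound:
  assumes F: "F holomorphic_on UNIV" and A: "R < A" and M: "0 \<le> M"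
    and inner: "\<And>z. cmod z \<le> A \<Longrightarrow> cmod (F z) \<le> B"
    and outer: "\<And>z. A < cmod z \<Longrightarrow> cmod (deriv F z) \<le> M * slope (cmod z)"
  shows "radial w z * cmod (F z) \<le> radial w z * B + M"
proof -
  have wz: "0 < radial w z" by (rule radial_pos[OF weight])
  have "cmod (F z) \<le> B + M / radial w z"
  proof (cases "cmod z \<le> A")
    case True
    have "0 \<le> M / radial w z" using M wz by simp
    with inner[OF True] show ?thesis by simp
  next
    case False
    define e where "e = z / of_real (cmod z)"
    have z: "z = of_real (cmod z) * e" "cmod e = 1" "A \<le> cmod z" "0 < A"
      using False A R_pos by (auto simp: e_def norm_divide)
    have "norm ((\<lambda>t. F (of_real t * e)) (cmod z) - (\<lambda>t. F (of_real t * e)) A)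
        \<le> (\<lambda>t. M * (1 / w t)) (cmod z) - (\<lambda>t. M * (1 / w t)) A"
    proof (rule differentiable_bound_general)
      show "A < cmod z" using False by simp
      show "continuous_on {A..cmod z} (\<lambda>t. F (of_real t * e))"
        by (intro continuous_on_compose2[OF holomorphic_on_imp_continuous_on[OF F]] continuous_intros) auto
      have "continuous_on {A..cmod z} w"
        using weight z(4) by (auto simp: is_weight_def intro: continuous_on_subset)
      moreover have "w t \<noteq> 0" if "t \<in> {A..cmod z}" for t
        using pos[of t] that z(4) by auto
      ultimately show "continuous_on {A..cmod z} (\<lambda>t. M * (1 / w t))"
        by (intro continuous_intros) auto
    next
      fix t assume t: "A < t" "t < cmod z"
      have "(F has_field_derivative deriv F (of_real t * e)) (at (of_real t * e))"
        using F by (auto intro: holomorphic_derivI)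
      then show "((\<lambda>t. F (of_real t * e)) has_vector_derivative e * deriv F (of_real t * e)) (at t)"
        by (intro field_vector_diff_chain_at[of "\<lambda>t. of_real t * e" e t F, unfolded o_def])
          (auto intro!: derivative_eq_intros)
      have "R < t" using t A by simp
      then show "((\<lambda>t. M * (1 / w t)) has_vector_derivative M * slope t) (at t)"
        using DERIV_cmult[OF inverse_weight_deriv[OF \<open>R < t\<close>], of M]
        by (simp add: has_real_derivative_iff_has_vector_derivative)
      show "norm (e * deriv F (of_real t * e)) \<le> M * slope t"
        using outer[of "of_real t * e"] t z by (simp add: norm_mult)
    qed
    then have "cmod (F z - F (of_real A * e)) \<le> M * (1 / w (cmod z)) - M * (1 / w A)"
      using z(1) by simp
    also have "\<dots> \<le> M / radial w z" using M pos[of A] z(4) by (simp add: radial_def)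
    finally have 1: "cmod (F z - F (of_real A * e)) \<le> M / radial w z" .
    have 2: "cmod (F (of_real A * e)) \<le> B" using inner[of "of_real A * e"] z by (simp add: norm_mult)
    have "F z = (F z - F (of_real A * e)) + F (of_real A * e)" by simp
    then have "cmod (F z) \<le> cmod (F z - F (of_real A * e)) + cmod (F (of_real A * e))"
      by (metis norm_triangle_ineq)
    with 1 2 show ?thesis by linarith
  qed
  from mult_left_mono[OF this less_imp_le[OF wz]] show ?thesis
    using wz by (simp add: distrib_left)
qed

lemma slope_imp_H0:
  assumes F: "F holomorphic_on UNIV"
    and small: "\<And>\<epsilon>. 0 < \<epsilon> \<Longrightarrow>
      \<forall>\<^sub>F z in at_infinity. cmod (deriv F z) \<le> \<epsilon> * slope (cmod z)"
  shows "F \<in> H0 (radial w)"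
proof -
  have "((\<lambda>z. radial w z * cmod (F z)) \<longlongrightarrow> 0) at_infinity"
  proof (rule tendstoI)
    fix \<epsilon> :: real assume "0 < \<epsilon>"
    obtain A0 where A0: "\<And>z. A0 \<le> cmod z \<Longrightarrow> cmod (deriv F z) \<le> (\<epsilon> / 2) * slope (cmod z)"
      using small[of "\<epsilon> / 2"] \<open>0 < \<epsilon>\<close> by (auto simp: eventually_at_infinity)
    define A where "A = max A0 (R + 1)"
    have "compact (F ` cball 0 A)"
      using holomorphic_on_imp_continuous_on[OF holomorphic_on_subset[OF F]]
      by (intro compact_continuous_image) auto
    then obtain B where B: "0 < B" "\<And>z. cmod z \<le> A \<Longrightarrow> cmod (F z) \<le> B"
      by (auto dest!: compact_imp_bounded simp: bounded_pos)
    have bound: "radial w z * cmod (F z) \<le> radial w z * B + \<epsilon> / 2" for z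
      by (rule integrate_slope_bound[OF F, of A]) (use B A0 \<open>0 < \<epsilon>\<close> in \<open>auto simp: A_def\<close>)
    have "\<forall>\<^sub>F r in at_top. w r < \<epsilon> / 2 / B"
      using weight_tendsto_0[OF weight] \<open>0 < \<epsilon>\<close> B by (auto intro: order_tendstoD(2))
    then have "\<forall>\<^sub>F z::complex in at_infinity. w (cmod z) < \<epsilon> / 2 / B"
      using eventually_compose_filterlim[OF _ filterlim_norm_at_top] by blast
    then show "\<forall>\<^sub>F z in at_infinity. dist (radial w z * cmod (F z)) 0 < \<epsilon>"
    proof eventually_elim
      case (elim z)
      then have "radial w z * B < \<epsilon> / 2" using B by (simp add: radial_def field_simps)
      with bound[of z] radial_pos[OF weight, of z] show ?case by (simp add: abs_mult)
    qed
  qed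
  with F show ?thesis by (simp add: H0_def)
qed

end

section \<open>The Volterra operator\<close>

lemma deriv_diff_entire:
  assumes "F holomorphic_on UNIV" "G holomorphic_on UNIV"
  shows "deriv (\<lambda>z. F z - G z) z = deriv F z - deriv G z"
  using assms by (intro deriv_diff) (auto simp: holomorphic_on_open field_differentiable_def)

lemma deriv_add_entire:
  assumes "F holomorphic_on UNIV" "G holomorphic_on UNIV"
  shows "deriv (\<lambda>z. F z + G z) z = deriv F z + deriv G z"
  using assms by (intro deriv_add) (auto simp: holomorphic_on_open field_differentiable_def)

lemma deriv_cmult_entire:
  assumes "F holomorphic_on UNIV"
  shows "deriv (\<lambda>z. c * F z) z = c * deriv F z"
  using assms by (intro deriv_cmult) (auto simp: holomorphic_on_open field_differentiable_def)

lemma has_derivative_volterra: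
  assumes "f holomorphic_on UNIV" "g holomorphic_on UNIV"
  shows "(volterra g f has_field_derivative f z * deriv g z) (at z)"
proof -
  have "(\<lambda>\<zeta>. f \<zeta> * deriv g \<zeta>) holomorphic_on UNIV"
    using assms by (auto intro!: holomorphic_intros holomorphic_deriv)
  then obtain P where P: "\<And>z. (P has_field_derivative f z * deriv g z) (at z)"
    using holomorphic_convex_primitive'[of UNIV] by auto
  have "volterra g f z = P z - P 0" for z
    using contour_integral_primitive[of UNIV P "\<lambda>\<zeta>. f \<zeta> * deriv g \<zeta>" "linepath 0 z"] P
    unfolding volterra_def by (intro contour_integral_unique) auto
  then have "volterra g f = (\<lambda>z. P z - P 0)" by auto
  then show ?thesis using P by (auto intro!: derivative_eq_intros)
qed

lemma
  assumes "f holomorphic_on UNIV" "g holomorphic_on UNIV"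
  shows holomorphic_volterra: "volterra g f holomorphic_on UNIV"
    and deriv_volterra: "deriv (volterra g f) z = f z * deriv g z"
proof -
  show "volterra g f holomorphic_on UNIV"
    using has_derivative_volterra[OF assms] by (auto simp: holomorphic_on_open)
  show "deriv (volterra g f) z = f z * deriv g z"
    by (rule DERIV_imp_deriv[OF has_derivative_volterra[OF assms]])
qed

lemma volterra_integrable:
  assumes "f holomorphic_on UNIV" "g holomorphic_on UNIV"
  shows "(\<lambda>\<zeta>. f \<zeta> * deriv g \<zeta>) contour_integrable_on linepath 0 z"
proof -
  have "(\<lambda>\<zeta>. f \<zeta> * deriv g \<zeta>) holomorphic_on UNIV"
    using assms by (auto intro!: holomorphic_intros holomorphic_deriv)
  then show ?thesis
    using contour_integrable_continuous_linepath holomorphic_on_imp_continuous_on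
      holomorphic_on_subset by blast
qed

lemma volterra_add:
  assumes "f holomorphic_on UNIV" "h holomorphic_on UNIV" "g holomorphic_on UNIV"
  shows "volterra g (\<lambda>z. f z + h z) = (\<lambda>z. volterra g f z + volterra g h z)"
  unfolding volterra_def distrib_right
  by (intro ext contour_integral_add volterra_integrable assms)

lemma volterra_diff:
  assumes "f holomorphic_on UNIV" "h holomorphic_on UNIV" "g holomorphic_on UNIV"
  shows "volterra g (\<lambda>z. f z - h z) = (\<lambda>z. volterra g f z - volterra g h z)"
  unfolding volterra_def left_diff_distrib
  by (intro ext contour_integral_diff volterra_integrable assms)

lemma volterra_cmult:
  assumes "f holomorphic_on UNIV" "g holomorphic_on UNIV"
  shows "volterra g (\<lambda>z. c * f z) = (\<lambda>z. c * volterra g f z)"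
  unfolding volterra_def mult.assoc
  by (intro ext contour_integral_lmul volterra_integrable assms)

lemma volterra_le:
  assumes f: "f holomorphic_on UNIV" and g: "g holomorphic_on UNIV" and z: "cmod z \<le> A"
    and bound: "\<And>\<zeta>. cmod \<zeta> \<le> A \<Longrightarrow> cmod (f \<zeta> * deriv g \<zeta>) \<le> B"
  shows "cmod (volterra g f z) \<le> A * B"
proof -
  have A: "0 \<le> A" using z norm_ge_zero order_trans by blast
  have B: "0 \<le> B" using order_trans[OF norm_ge_zero bound[of 0]] A by simp
  have "cmod (volterra g f z) \<le> B * cmod (z - 0)"
    unfolding volterra_def
  proof (rule contour_integral_bound_linepath[OF volterra_integrable[OF f g] B])
    fix \<zeta> assume "\<zeta> \<in> closed_segment 0 z"
    then have "cmod \<zeta> \<le> cmod z" using segment_bound1[of \<zeta> 0 z] by simp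
    then show "cmod (f \<zeta> * deriv g \<zeta>) \<le> B" using z by (intro bound) simp
  qed
  also have "\<dots> \<le> B * A" using B z by (intro mult_left_mono) auto
  finally show ?thesis by (simp add: mult.commute)
qed

section \<open>Norm and weak topologies\<close>

lemma relatively_compactin_subset:
  assumes "Hausdorff_space X" "compactin X K" "S \<subseteq> K"
  shows "relatively_compactin X S"
proof -
  have "closedin X K" by (rule compactin_imp_closedin[OF assms(1,2)])
  then have "X closure_of S \<subseteq> K" using assms(3) by (rule closure_of_minimal[rotated])
  then show ?thesis
    using assms closed_compactin[OF assms(2)] compactin_subset_topspace[OF assms(2)]
    by (auto simp: relatively_compactin_def)
qed

lemma subset_closure_of_relatively_compactin:
  assumes "relatively_compactin X S"
  shows "compactin X (X closure_of S)" "S \<subseteq> X closure_of S"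
  using assms closure_of_subset unfolding relatively_compactin_def by auto

lemma openin_weak_topology:
  "\<phi> \<in> dual X N \<Longrightarrow> open U \<Longrightarrow> openin (weak_topology X N) {f \<in> X. \<phi> f \<in> U}"
  unfolding weak_topology_def by (rule topology_generated_by_Basis) blast

text \<open>A bounded additive functional is Lipschitz for the norm distance.\<close>

lemma openin_norm_topology_dual:
  assumes M: "Metric_space X (norm_dist X N)"
    and minus: "\<And>f h. f \<in> X \<Longrightarrow> h \<in> X \<Longrightarrow> (\<lambda>z. f z - h z) \<in> X"
    and \<phi>: "\<phi> \<in> dual X N" and U: "open U"
  shows "openin (norm_topology X N) {f \<in> X. \<phi> f \<in> U}"
  unfolding norm_topology_def Metric_space.openin_mtopology[OF M]
proof (intro conjI allI impI)
  fix f assume f: "f \<in> {f \<in> X. \<phi> f \<in> U}"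
  obtain e where e: "0 < e" "ball (\<phi> f) e \<subseteq> U" using U f by (auto simp: open_contains_ball)
  obtain K where K: "\<And>f. f \<in> X \<Longrightarrow> cmod (\<phi> f) \<le> K * N f"
    using \<phi> unfolding dual_def by blast
  have add: "\<forall>f\<in>X. \<forall>h\<in>X. \<phi> (\<lambda>z. f z + h z) = \<phi> f + \<phi> h"
    using \<phi> unfolding dual_def by blast
  have "Metric_space.mball X (norm_dist X N) f (e / (\<bar>K\<bar> + 1)) \<subseteq> {f \<in> X. \<phi> f \<in> U}"
  proof
    fix h assume "h \<in> Metric_space.mball X (norm_dist X N) f (e / (\<bar>K\<bar> + 1))"
    then have h: "h \<in> X" "norm_dist X N f h < e / (\<bar>K\<bar> + 1)"
      by (auto simp: Metric_space.in_mball[OF M])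
    let ?d = "\<lambda>z. f z - h z"
    have d: "?d \<in> X" using minus f h by auto
    have Nd: "norm_dist X N f h = N ?d" using f h by (simp add: norm_dist_def)
    have N0: "0 \<le> N ?d" using Metric_space.nonneg[OF M, of f h] Nd by simp
    have "\<phi> (\<lambda>z. ?d z + h z) = \<phi> ?d + \<phi> h" using add[rule_format, OF d h(1)] .
    then have "\<phi> f - \<phi> h = \<phi> ?d" by simp
    then have "cmod (\<phi> f - \<phi> h) \<le> K * N ?d" using K[OF d] by simp
    also have "\<dots> \<le> (\<bar>K\<bar> + 1) * N ?d" using N0 by (intro mult_right_mono) auto
    also have "\<dots> < e" using h(2) Nd by (simp add: field_simps)
    finally show "h \<in> {f \<in> X. \<phi> f \<in> U}" using e(2) h by (auto simp: dist_norm)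
  qed
  then show "\<exists>r>0. Metric_space.mball X (norm_dist X N) f r \<subseteq> {f \<in> X. \<phi> f \<in> U}"
    using e by (intro exI[of _ "e / (\<bar>K\<bar> + 1)"]) auto
qed auto

lemma norm_compactin_imp_weak_compactin:
  assumes M: "Metric_space X (norm_dist X N)"
    and minus: "\<And>f h. f \<in> X \<Longrightarrow> h \<in> X \<Longrightarrow> (\<lambda>z. f z - h z) \<in> X"
    and K: "compactin (norm_topology X N) K"
  shows "compactin (weak_topology X N) K"
proof -
  have top: "topspace (norm_topology X N) = X"
    unfolding norm_topology_def by (rule Metric_space.topspace_mtopology[OF M])
  have "continuous_map (norm_topology X N) (weak_topology X N) (\<lambda>f. f)"
    unfolding weak_topology_def
  proof (rule continuous_on_generated_topo)
    fix U assume "U \<in> {{f \<in> X. \<phi> f \<in> U} |\<phi> U. \<phi> \<in> dual X N \<and> open U}"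
    then obtain \<phi> U' where U: "U = {f \<in> X. \<phi> f \<in> U'}" "\<phi> \<in> dual X N" "open U'" by blast
    have "openin (norm_topology X N) U"
      unfolding U(1) by (rule openin_norm_topology_dual[OF M minus U(2,3)])
    then show "openin (norm_topology X N) ((\<lambda>f. f) -` U \<inter> topspace (norm_topology X N))"
      by (simp add: openin_Int)
  next
    show "(\<lambda>f. f) ` topspace (norm_topology X N) \<subseteq>
        \<Union> {{f \<in> X. \<phi> f \<in> U} |\<phi> U. \<phi> \<in> dual X N \<and> open U}"
      using topspace_weak_topology[of X N] top
      unfolding weak_topology_def topology_generated_by_topspace by auto
  qed
  from image_compactin[OF K this] show ?thesis by simp
qed

lemma Hausdorff_weak_topology:
  assumes "\<And>f h. f \<in> X \<Longrightarrow> h \<in> X \<Longrightarrow> f \<noteq> h \<Longrightarrow> \<exists>\<phi>\<in>dual X N. \<phi> f \<noteq> \<phi> h"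
  shows "Hausdorff_space (weak_topology X N)"
  unfolding Hausdorff_space_def
proof (intro allI impI)
  fix f h assume "f \<in> topspace (weak_topology X N) \<and> h \<in> topspace (weak_topology X N) \<and> f \<noteq> h"
  then have fh: "f \<in> X" "h \<in> X" "f \<noteq> h" by auto
  then obtain \<phi> where \<phi>: "\<phi> \<in> dual X N" "\<phi> f \<noteq> \<phi> h" using assms by blast
  obtain A B where AB: "open A" "open B" "\<phi> f \<in> A" "\<phi> h \<in> B" "A \<inter> B = {}"
    using hausdorff[OF \<phi>(2)] by blast
  show "\<exists>U V. openin (weak_topology X N) U \<and> openin (weak_topology X N) V \<and> f \<in> U \<and> h \<in> V \<and> disjnt U V"
    using openin_weak_topology[OF \<phi>(1) AB(1)] openin_weak_topology[OF \<phi>(1) AB(2)] AB fh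
    by (intro exI[of _ "{f \<in> X. \<phi> f \<in> A}"] exI[of _ "{f \<in> X. \<phi> f \<in> B}"]) (auto simp: disjnt_def)
qed

text \<open>Otherwise \<open>K\<close> would be covered by the weakly open sets on which some \<open>\<phi> \<in> \<Phi>\<close> stays away from
  \<open>a \<phi>\<close>, and a finite subcover would eventually miss the points \<open>s n\<close>.  This replaces a convergent
  subsequence, which would require the Eberlein--Smulian theorem.\<close>

lemma weak_cluster_point:
  fixes s :: "nat \<Rightarrow> 'a \<Rightarrow> complex"
  assumes K: "compactin (weak_topology X N) K" and s: "\<And>n. s n \<in> K" and \<Phi>: "\<Phi> \<subseteq> dual X N"
    and lim: "\<And>\<phi>. \<phi> \<in> \<Phi> \<Longrightarrow> (\<lambda>n. \<phi> (s n)) \<longlonglongrightarrow> a \<phi>"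
  obtains h where "h \<in> K" "\<And>\<phi>. \<phi> \<in> \<Phi> \<Longrightarrow> \<phi> h = a \<phi>"
proof -
  have "\<exists>h\<in>K. \<forall>\<phi>\<in>\<Phi>. \<phi> h = a \<phi>"
  proof (rule ccontr)
    assume no: "\<not> ?thesis"
    have KX: "K \<subseteq> X" using compactin_subset_topspace[OF K] by simp
    define \<U> where "\<U> = {{f \<in> X. \<phi> f \<in> - cball (a \<phi>) e} | \<phi> e. \<phi> \<in> \<Phi> \<and> 0 < e}"
    have op: "\<forall>U\<in>\<U>. openin (weak_topology X N) U"
    proof
      fix U assume "U \<in> \<U>"
      then obtain \<phi> e where "U = {f \<in> X. \<phi> f \<in> - cball (a \<phi>) e}" "\<phi> \<in> \<Phi>"
        by (auto simp: \<U>_def)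
      then show "openin (weak_topology X N) U"
        using openin_weak_topology[of \<phi> X N "- cball (a \<phi>) e"] \<Phi> by (auto simp: open_Compl)
    qed
    have cover: "K \<subseteq> \<Union>\<U>"
    proof
      fix h assume h: "h \<in> K"
      then obtain \<phi> where \<phi>: "\<phi> \<in> \<Phi>" "\<phi> h \<noteq> a \<phi>" using no by blast
      then have "h \<in> {f \<in> X. \<phi> f \<in> - cball (a \<phi>) (dist (a \<phi>) (\<phi> h) / 2)}"
        using h KX by auto
      moreover have "{f \<in> X. \<phi> f \<in> - cball (a \<phi>) (dist (a \<phi>) (\<phi> h) / 2)} \<in> \<U>"
        unfolding \<U>_def using \<phi>
        by (intro CollectI exI[of _ \<phi>] exI[of _ "dist (a \<phi>) (\<phi> h) / 2"]) auto
      ultimately show "h \<in> \<Union>\<U>" by blast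
    qed
    obtain \<F> where \<F>: "finite \<F>" "\<F> \<subseteq> \<U>" "K \<subseteq> \<Union>\<F>"
      using K op cover unfolding compactin_def by meson
    have "\<forall>\<^sub>F n in sequentially. s n \<notin> U" if UF: "U \<in> \<F>" for U
    proof -
      obtain \<phi> e where U: "U = {f \<in> X. \<phi> f \<in> - cball (a \<phi>) e}" "\<phi> \<in> \<Phi>" "0 < e"
        using UF \<F>(2) unfolding \<U>_def by blast
      have "\<forall>\<^sub>F n in sequentially. dist (\<phi> (s n)) (a \<phi>) < e"
        using lim[OF U(2)] U(3) by (rule tendstoD)
      then show ?thesis by eventually_elim (auto simp: U(1) dist_commute)
    qed
    then have "\<forall>\<^sub>F n in sequentially. \<forall>U\<in>\<F>. s n \<notin> U"
      using \<F>(1) by (intro eventually_ball_finite) auto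
    then obtain n where "\<forall>U\<in>\<F>. s n \<notin> U" by (auto simp: eventually_sequentially)
    then show False using s[of n] \<F>(3) by blast
  qed
  with that show thesis by blast
qed

lemma point_evaluation_dual:
  assumes "\<And>z. 0 < u z" "X \<subseteq> Hinf u"
  shows "(\<lambda>f. f z) \<in> dual X (wnorm u)"
  unfolding dual_def
proof (intro CollectI conjI ballI allI exI[of _ "1 / u z"])
  fix f assume "f \<in> X"
  then show "cmod (f z) \<le> 1 / u z * wnorm u f"
    using cmod_le_wnorm_divide[of u f z] assms by auto
qed auto

text \<open>Point evaluations determine a function, so a weak cluster point of a pointwise convergent sequence is
  its pointwise limit, and a functional vanishing along the sequence vanishes at that limit.\<close>

lemma weak_cluster_point_pointwise:
  fixes s :: "nat \<Rightarrow> complex \<Rightarrow> complex"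
  assumes u: "\<And>z. 0 < u z" "X \<subseteq> Hinf u"
    and K: "compactin (weak_topology X (wnorm u)) K" and s: "\<And>n. s n \<in> K"
    and lim: "\<And>z. (\<lambda>n. s n z) \<longlonglongrightarrow> F z"
  shows "F \<in> K" and "\<phi> \<in> dual X (wnorm u) \<Longrightarrow> (\<And>n. \<phi> (s n) = 0) \<Longrightarrow> \<phi> F = 0"
proof -
  let ?E = "range (\<lambda>z (f :: complex \<Rightarrow> complex). f z)"
  have E: "?E \<subseteq> dual X (wnorm u)" using point_evaluation_dual[OF u] by blast
  have *: "F \<in> K \<and> \<phi> F = 0" if \<phi>: "\<phi> \<in> dual X (wnorm u)" "\<And>n. \<phi> (s n) = 0" for \<phi>
  proof -
    obtain h where h: "h \<in> K" "\<And>\<psi>. \<psi> \<in> insert \<phi> ?E \<Longrightarrow> \<psi> h = lim (\<lambda>n. \<psi> (s n))"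
    proof (rule weak_cluster_point[OF K, where s = s and \<Phi> = "insert \<phi> ?E"
          and a = "\<lambda>\<psi>. lim (\<lambda>n. \<psi> (s n))"])
      show "\<And>n. s n \<in> K" by (rule s)
      show "insert \<phi> ?E \<subseteq> dual X (wnorm u)" using E \<phi>(1) by simp
      show "(\<lambda>n. \<psi> (s n)) \<longlonglongrightarrow> lim (\<lambda>n. \<psi> (s n))" if "\<psi> \<in> insert \<phi> ?E" for \<psi>
      proof -
        have "\<psi> = \<phi> \<or> (\<exists>z. \<psi> = (\<lambda>f. f z))" using that by auto
        then have "convergent (\<lambda>n. \<psi> (s n))"
          using lim \<phi>(2) by (auto simp: convergent_const intro: convergentI)
        then show ?thesis by (simp add: convergent_LIMSEQ_iff)
      qed
    qed blast
    have "h z = F z" for z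
      using h(2)[of "\<lambda>f. f z"] limI[OF lim[of z]] by simp
    then have "h = F" by auto
    moreover have "\<phi> h = 0" using h(2)[of \<phi>] \<phi>(2) by simp
    ultimately show ?thesis using h(1) by simp
  qed
  have "(\<lambda>f. 0) \<in> dual X (wnorm u)" by (auto simp: dual_def intro!: exI[of _ 0])
  from *[OF this] show "F \<in> K" by simp
  show "\<phi> \<in> dual X (wnorm u) \<Longrightarrow> (\<And>n. \<phi> (s n) = 0) \<Longrightarrow> \<phi> F = 0" using * by blast
qed

section \<open>Limits along an ultrafilter\<close>

text \<open>Minimal proper filters are ultrafilters; Zorn's lemma applies since a chain of proper filters has a proper infimum.\<close>

lemma exists_minimal_filter:
  fixes F0 :: "'a filter"
  assumes "F0 \<noteq> bot"
  obtains U where "U \<le> F0" "U \<noteq> bot" "\<And>G. G \<le> U \<Longrightarrow> G \<noteq> bot \<Longrightarrow> G = U"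
proof -
  let ?A = "{F. F \<le> F0 \<and> F \<noteq> bot}"
  have "\<exists>m\<in>?A. \<forall>a\<in>?A. a \<le> m \<longrightarrow> a = m"
  proof (rule predicate_Zorn)
    show "partial_order_on ?A (relation_of (\<lambda>F G. G \<le> F) ?A)"
      by (rule partial_order_on_relation_ofI) auto
    fix C assume "C \<in> Chains (relation_of (\<lambda>F G. G \<le> F) ?A)"
    then have CA: "C \<subseteq> ?A" and chain: "\<And>F G. F \<in> C \<Longrightarrow> G \<in> C \<Longrightarrow> F \<le> G \<or> G \<le> F"
      by (auto simp: Chains_def relation_of_def)
    show "\<exists>u\<in>?A. \<forall>a\<in>C. u \<le> a"
    proof (cases "C = {}")
      case True
      then show ?thesis using assms by auto
    next
      case False
      have "eventually P (Inf C) \<longleftrightarrow> (\<exists>F\<in>C. eventually P F)" for P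
        using False chain by (intro eventually_Inf_base) (metis inf.absorb_iff2 inf.orderE order_refl)+
      then have "Inf C \<noteq> bot"
        using CA by (auto simp: trivial_limit_def)
      moreover have "Inf C \<le> F0"
        using False CA by (auto intro: order_trans[OF Inf_lower])
      ultimately show ?thesis by (intro bexI[of _ "Inf C"]) (auto intro: Inf_lower)
    qed
  qed
  with that show thesis by (metis (mono_tags, lifting) mem_Collect_eq order_trans)
qed

text \<open>A bounded sequence has a cluster point \<open>l\<close> along \<open>U\<close>; adding the preimages of the
  neighbourhoods of \<open>l\<close> to \<open>U\<close> gives a proper filter, which by minimality is \<open>U\<close> again.\<close>

lemma ultrafilter_limits:
  obtains U :: "nat filter" where "U \<le> sequentially" "U \<noteq> bot"
    "\<forall>(x :: nat \<Rightarrow> complex) B. (\<forall>n. cmod (x n) \<le> B) \<longrightarrow> (\<exists>l. (x \<longlongrightarrow> l) U)"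
proof -
  obtain U :: "nat filter" where U: "U \<le> sequentially" "U \<noteq> bot"
    and min: "\<And>G. G \<le> U \<Longrightarrow> G \<noteq> bot \<Longrightarrow> G = U"
    using exists_minimal_filter[OF sequentially_bot] by blast
  have "\<exists>l. (x \<longlongrightarrow> l) U" if B: "\<And>n. cmod (x n) \<le> B" for x :: "nat \<Rightarrow> complex" and B
  proof -
    have "compact (cball (0::complex) B)" by simp
    moreover have "filtermap x U \<noteq> bot" using U(2) by (simp add: filtermap_bot_iff)
    moreover have "eventually (\<lambda>y. y \<in> cball 0 B) (filtermap x U)"
      using B by (simp add: eventually_filtermap)
    ultimately obtain l where l: "inf (nhds l) (filtermap x U) \<noteq> bot"
      unfolding compact_filter by blast
    \<comment> \<open>the sets of indices along which \<open>x\<close> is near \<open>l\<close> meet all sets of \<open>U\<close>\<close>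
    have "inf (filtercomap x (nhds l)) U \<noteq> bot"
    proof
      assume "inf (filtercomap x (nhds l)) U = bot"
      then obtain P Q where PQ: "eventually P (nhds l)" "eventually Q U" "\<And>n. P (x n) \<Longrightarrow> Q n \<Longrightarrow> False"
        unfolding trivial_limit_def eventually_inf eventually_filtercomap by blast
      have "eventually (\<lambda>y. \<not> P y) (filtermap x U)"
        unfolding eventually_filtermap using PQ(2) by (rule eventually_mono) (use PQ(3) in blast)
      with PQ(1) have "eventually (\<lambda>_. False) (inf (nhds l) (filtermap x U))"
        unfolding eventually_inf by blast
      then show False using l by (simp add: trivial_limit_def)
    qed
    with min[of "inf (filtercomap x (nhds l)) U"] have "U \<le> filtercomap x (nhds l)"
      by (metis inf_le1 inf_le2)
    then show ?thesis by (auto simp: filterlim_def filtermap_le_iff_le_filtercomap)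
  qed
  with U that show thesis by blast
qed

section \<open>Compactness of the Volterra operator\<close>

locale volterra_weights = regular_weight w R C for w R C +
  fixes v :: "real \<Rightarrow> real" and g :: "complex \<Rightarrow> complex"
  assumes v: "is_weight v" and g: "g holomorphic_on UNIV"
begin

definition small_symbol :: bool where
  "small_symbol \<longleftrightarrow> (\<forall>\<epsilon>>0. \<forall>\<^sub>F z in at_infinity.
      cmod (deriv g z) \<le> \<epsilon> * assoc_weight (radial v) z * slope (cmod z))"

lemma eventually_gt_R: "\<forall>\<^sub>F z::complex in at_infinity. R < cmod z"
  using eventually_compose_filterlim[OF eventually_gt_at_top filterlim_norm_at_top] by blast

text \<open>As \<open>w' < 0\<close>, the quotient is \<open>- |g'|\<close> divided by the associated weight of \<open>v\<close> and by the slope of \<open>w\<close>.\<close>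

lemma small_symbol_iff:
  "((\<lambda>z. (radial w z)\<^sup>2 * cmod (deriv g z) / (radial (deriv w) z * assoc_weight (radial v) z))
      \<longlongrightarrow> 0) at_infinity \<longleftrightarrow> small_symbol"
  (is "(?q \<longlongrightarrow> 0) _ \<longleftrightarrow> _")
proof -
  let ?a = "assoc_weight (radial v)"
  have abs_q: "\<bar>?q z\<bar> = cmod (deriv g z) / (?a z * slope (cmod z))" if "R < cmod z" for z
    using deriv_neg[OF that] pos[of "cmod z"] assoc_weight_pos[OF v, of z]
    by (simp add: radial_def slope_def abs_mult mult_ac)
  have le_iff: "\<bar>?q z\<bar> \<le> \<epsilon> \<longleftrightarrow> cmod (deriv g z) \<le> \<epsilon> * ?a z * slope (cmod z)"
    if "R < cmod z" for z \<epsilon>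
    unfolding abs_q[OF that] using slope_pos[OF that] assoc_weight_pos[OF v, of z]
    by (simp add: pos_divide_le_eq mult.assoc)
  have "(?q \<longlongrightarrow> 0) at_infinity \<longleftrightarrow> (\<forall>\<epsilon>>0. \<forall>\<^sub>F z in at_infinity. \<bar>?q z\<bar> \<le> \<epsilon>)"
  proof
    assume lim: "(?q \<longlongrightarrow> 0) at_infinity"
    show "\<forall>\<epsilon>>0. \<forall>\<^sub>F z in at_infinity. \<bar>?q z\<bar> \<le> \<epsilon>"
    proof (intro allI impI)
      fix \<epsilon> :: real assume "0 < \<epsilon>"
      from tendstoD[OF lim this] show "\<forall>\<^sub>F z in at_infinity. \<bar>?q z\<bar> \<le> \<epsilon>"
        by eventually_elim simp
    qed
  next
    assume le: "\<forall>\<epsilon>>0. \<forall>\<^sub>F z in at_infinity. \<bar>?q z\<bar> \<le> \<epsilon>"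
    show "(?q \<longlongrightarrow> 0) at_infinity"
    proof (rule tendstoI)
      fix \<epsilon> :: real assume "0 < \<epsilon>"
      then have "\<forall>\<^sub>F z in at_infinity. \<bar>?q z\<bar> \<le> \<epsilon> / 2" using le half_gt_zero by blast
      then show "\<forall>\<^sub>F z in at_infinity. dist (?q z) 0 < \<epsilon>"
      proof eventually_elim
        case (elim z)
        with \<open>0 < \<epsilon>\<close> have "\<bar>?q z\<bar> < \<epsilon>" by linarith
        then show ?case by (simp only: dist_real_def diff_zero)
      qed
    qed
  qed
  also have "\<dots> \<longleftrightarrow> small_symbol"
    unfolding small_symbol_def
  proof (intro all_cong imp_cong refl)
    fix \<epsilon> :: real
    show "(\<forall>\<^sub>F z in at_infinity. \<bar>?q z\<bar> \<le> \<epsilon>) \<longleftrightarrow>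
        (\<forall>\<^sub>F z in at_infinity. cmod (deriv g z) \<le> \<epsilon> * ?a z * slope (cmod z))"
      by (rule eventually_cong[OF eventually_gt_R le_iff])
  qed
  finally show ?thesis .
qed

lemma deriv_volterra_le:
  assumes f: "f \<in> Hinf (radial v)" and z: "R < cmod z"
    and symb: "cmod (deriv g z) \<le> \<epsilon> * assoc_weight (radial v) z * slope (cmod z)" and "0 \<le> \<epsilon>"
  shows "cmod (deriv (volterra g f) z) \<le> \<epsilon> * wnorm (radial v) f * slope (cmod z)"
proof -
  have "cmod (deriv (volterra g f) z) = cmod (f z) * cmod (deriv g z)"
    using f g by (simp add: Hinf_def deriv_volterra norm_mult)
  also have "\<dots> \<le> cmod (f z) * (\<epsilon> * assoc_weight (radial v) z * slope (cmod z))"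
    using symb by (intro mult_left_mono) auto
  also have "\<dots> = (cmod (f z) * assoc_weight (radial v) z) * (\<epsilon> * slope (cmod z))"
    by (simp add: mult_ac)
  also have "\<dots> \<le> wnorm (radial v) f * (\<epsilon> * slope (cmod z))"
    using Hinf_cmod_le_assoc[OF v f] slope_pos[OF z] \<open>0 \<le> \<epsilon>\<close>
    by (intro mult_right_mono) auto
  finally show ?thesis by (simp add: mult_ac)
qed

lemma volterra_in_H0:
  assumes small: small_symbol and f: "f \<in> Hinf (radial v)"
  shows "volterra g f \<in> H0 (radial w)"
proof (rule slope_imp_H0)
  show "volterra g f holomorphic_on UNIV"
    using f g by (simp add: Hinf_def holomorphic_volterra)
  fix \<epsilon> :: real assume "0 < \<epsilon>"
  let ?N = "wnorm (radial v) f" let ?e = "\<epsilon> / (?N + 1)"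
  have N: "0 \<le> ?N" by (rule wnorm_nonneg[OF radial_pos[OF v] f])
  have e: "0 < ?e" using \<open>0 < \<epsilon>\<close> N by simp
  have "\<forall>\<^sub>F z in at_infinity. cmod (deriv g z) \<le> ?e * assoc_weight (radial v) z * slope (cmod z)"
    using small e by (simp only: small_symbol_def)
  with eventually_gt_R
  show "\<forall>\<^sub>F z in at_infinity. cmod (deriv (volterra g f) z) \<le> \<epsilon> * slope (cmod z)"
  proof eventually_elim
    case (elim z)
    have "cmod (deriv (volterra g f) z) \<le> ?e * ?N * slope (cmod z)"
      using deriv_volterra_le[OF f elim] e by simp
    also have "\<dots> \<le> \<epsilon> * slope (cmod z)"
      using N \<open>0 < \<epsilon>\<close> slope_pos[OF elim(1)] by (intro mult_right_mono) (auto simp: field_simps)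
    finally show ?case .
  qed
qed

text \<open>The source of compactness: up to a small multiple of the norm of \<open>f\<close>, the norm of \<open>V\<^sub>g f\<close> is
  controlled by the values of \<open>f\<close> on a compact disc.\<close>

lemma volterra_estimate:
  assumes small: small_symbol and "0 < \<epsilon>"
  obtains A K where "0 < A" "0 < K"
    "\<And>f m. f \<in> Hinf (radial v) \<Longrightarrow> (\<And>z. cmod z \<le> A \<Longrightarrow> cmod (f z) \<le> m) \<Longrightarrow>
        wnorm (radial w) (volterra g f) \<le> K * m + \<epsilon> * wnorm (radial v) f"
proof -
  have "\<forall>\<^sub>F z in at_infinity. cmod (deriv g z) \<le> \<epsilon> * assoc_weight (radial v) z * slope (cmod z)"
    using small \<open>0 < \<epsilon>\<close> by (simp add: small_symbol_def)
  then obtain A0 where A0: "\<And>z. A0 \<le> cmod z \<Longrightarrow>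
      cmod (deriv g z) \<le> \<epsilon> * assoc_weight (radial v) z * slope (cmod z)"
    by (auto simp: eventually_at_infinity)
  define A where "A = max A0 (R + 1)"
  have A: "R < A" "0 < A" "A0 \<le> A" using R_pos by (auto simp: A_def)
  have "deriv g holomorphic_on UNIV" using g by (auto intro: holomorphic_deriv)
  from holomorphic_on_imp_continuous_on[OF holomorphic_on_subset[OF this subset_UNIV]]
  have "compact (deriv g ` cball 0 A)" by (intro compact_continuous_image) auto
  then obtain G where G: "0 < G" "\<And>z. cmod z \<le> A \<Longrightarrow> cmod (deriv g z) \<le> G"
    by (auto dest!: compact_imp_bounded simp: bounded_pos)
  show thesis
  proof (rule that[of A "w 0 * (A * G)"])
    show "0 < A" "0 < w 0 * (A * G)" using A G pos[of 0] by auto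
    fix f m assume f: "f \<in> Hinf (radial v)" and m: "\<And>z. cmod z \<le> A \<Longrightarrow> cmod (f z) \<le> m"
    have hol: "f holomorphic_on UNIV" using f by (simp add: Hinf_def)
    have m0: "0 \<le> m" using order_trans[OF norm_ge_zero m[of 0]] A by simp
    have N: "0 \<le> wnorm (radial v) f" by (rule wnorm_nonneg[OF radial_pos[OF v] f])
    show "wnorm (radial w) (volterra g f) \<le> w 0 * (A * G) * m + \<epsilon> * wnorm (radial v) f"
    proof (rule wnorm_le[OF holomorphic_volterra[OF hol g]])
      fix z
      have "radial w z * cmod (volterra g f z) \<le> radial w z * (A * (m * G)) + \<epsilon> * wnorm (radial v) f"
      proof (rule integrate_slope_bound[OF holomorphic_volterra[OF hol g] A(1)])
        show "0 \<le> \<epsilon> * wnorm (radial v) f" using N \<open>0 < \<epsilon>\<close> by simp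
        fix z assume "cmod z \<le> A"
        then show "cmod (volterra g f z) \<le> A * (m * G)"
          using m G m0 by (intro volterra_le[OF hol g]) (auto simp: norm_mult intro!: mult_mono)
      next
        fix z assume "A < cmod z"
        then show "cmod (deriv (volterra g f) z) \<le> \<epsilon> * wnorm (radial v) f * slope (cmod z)"
          using A A0[of z] \<open>0 < \<epsilon>\<close> by (intro deriv_volterra_le[OF f]) auto
      qed
      also have "\<dots> \<le> w 0 * (A * (m * G)) + \<epsilon> * wnorm (radial v) f"
        using radial_le_0[OF weight, of z] A G m0 by (intro add_right_mono mult_right_mono) auto
      finally show "radial w z * cmod (volterra g f z) \<le> w 0 * (A * G) * m + \<epsilon> * wnorm (radial v) f"
        by (simp add: mult_ac)
    qed
  qed
qed

lemma volterra_bounded_op: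
  assumes small: small_symbol and X: "X \<subseteq> Hinf (radial v)" and Y: "H0 (radial w) \<subseteq> Y"
  shows "bounded_op (volterra g) X (wnorm (radial v)) Y (wnorm (radial w))"
proof -
  have hol: "f holomorphic_on UNIV" if "f \<in> X" for f using that X by (auto simp: Hinf_def)
  obtain A K where AK: "0 < A" "0 < K"
    "\<And>f m. f \<in> Hinf (radial v) \<Longrightarrow> (\<And>z. cmod z \<le> A \<Longrightarrow> cmod (f z) \<le> m) \<Longrightarrow>
        wnorm (radial w) (volterra g f) \<le> K * m + 1 * wnorm (radial v) f"
    using volterra_estimate[OF small zero_less_one] by blast
  have "wnorm (radial w) (volterra g f) \<le> (K / v A + 1) * wnorm (radial v) f" if "f \<in> X" for f
  proof -
    have f: "f \<in> Hinf (radial v)" using that X by auto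
    have "cmod (f z) \<le> wnorm (radial v) f / v A" if "cmod z \<le> A" for z
    proof -
      have "cmod (f z) \<le> wnorm (radial v) f / radial v z"
        by (rule cmod_le_wnorm_divide[OF radial_pos[OF v] f])
      also have "\<dots> \<le> wnorm (radial v) f / v A"
        using weight_antimono[OF v, of "cmod z" A] that wnorm_nonneg[OF radial_pos[OF v] f]
          radial_pos[OF v, of "of_real A"] radial_pos[OF v, of z] AK(1)
        by (intro divide_left_mono) (auto simp: radial_def)
      finally show ?thesis .
    qed
    from AK(3)[OF f this] show ?thesis by (simp add: algebra_simps)
  qed
  then show ?thesis
    unfolding bounded_op_def
    using volterra_in_H0[OF small] X Y hol g by (auto simp: volterra_add volterra_cmult)
qed

text \<open>By Montel's theorem, a sequence in the unit ball has a subsequence converging locally uniformly; the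
  limit is again in the unit ball, and \<open>volterra_estimate\<close> turns locally uniform convergence into norm
  convergence of the images.  The unit ball of the large space is used for both target spaces,
  because its image lies in the small one.\<close>

lemma compactin_volterra_ball:
  assumes small: small_symbol and Y: "H0 (radial w) \<subseteq> Y" "Y \<subseteq> Hinf (radial w)"
    and M: "Metric_space Y (norm_dist Y (wnorm (radial w)))"
  shows "compactin (norm_topology Y (wnorm (radial w)))
           (volterra g ` {f \<in> Hinf (radial v). wnorm (radial v) f \<le> 1})"
  unfolding norm_topology_def Metric_space.compactin_sequentially[OF M]
proof (intro conjI allI impI)
  let ?B = "{f \<in> Hinf (radial v). wnorm (radial v) f \<le> 1}"
  have B_le: "cmod (f z) \<le> 1 / radial v z" if "f \<in> ?B" for f z
  proof -
    have "radial v z * cmod (f z) \<le> 1" using wnorm_ge[of f "radial v" z] that by auto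
    then show ?thesis using radial_pos[OF v, of z] by (simp add: field_simps)
  qed
  show "volterra g ` ?B \<subseteq> Y" using volterra_in_H0[OF small] Y by auto
  fix \<sigma> :: "nat \<Rightarrow> complex \<Rightarrow> complex" assume "range \<sigma> \<subseteq> volterra g ` ?B"
  then have "\<forall>n. \<exists>f\<in>?B. \<sigma> n = volterra g f" by blast
  then obtain \<phi> where \<phi>: "\<And>n. \<phi> n \<in> ?B" "\<And>n. \<sigma> n = volterra g (\<phi> n)" by metis
  obtain f r where fr: "f holomorphic_on UNIV" "strict_mono (r :: nat \<Rightarrow> nat)"
    "\<And>x. (\<lambda>n. \<phi> (r n) x) \<longlonglongrightarrow> f x"
    "\<And>K. compact K \<Longrightarrow> uniform_limit K (\<phi> \<circ> r) f sequentially"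
  proof (rule Montel[of UNIV ?B \<phi>])
    fix K :: "complex set" assume "compact K"
    then obtain a where a: "\<And>z. z \<in> K \<Longrightarrow> cmod z \<le> a" "0 < a"
      using compact_imp_bounded bounded_pos by metis
    have "cmod (h z) \<le> 1 / v a" if "h \<in> ?B" "z \<in> K" for h z
    proof -
      have "0 < v a" using v a(2) by (simp add: is_weight_def)
      then show ?thesis
        using B_le[OF that(1), of z] weight_antimono[OF v, of "cmod z" a] a(1)[OF that(2)]
        by (smt (verit, best) radial_def frac_le norm_ge_zero)
    qed
    then show "\<exists>B. \<forall>h\<in>?B. \<forall>z\<in>K. cmod (h z) \<le> B" by blast
  qed (use \<phi>(1) in \<open>auto simp: Hinf_def\<close>)
  have "radial v z * cmod (f z) \<le> 1" for z
  proof (rule tendsto_upperbound)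
    show "(\<lambda>n. radial v z * cmod (\<phi> (r n) z)) \<longlonglongrightarrow> radial v z * cmod (f z)"
      by (intro tendsto_intros fr)
    show "\<forall>\<^sub>F n in sequentially. radial v z * cmod (\<phi> (r n) z) \<le> 1"
    proof (intro always_eventually allI)
      fix n
      show "radial v z * cmod (\<phi> (r n) z) \<le> 1"
        using B_le[OF \<phi>(1), of "r n" z] radial_pos[OF v, of z] by (simp add: field_simps)
    qed
  qed simp
  with fr(1) have f: "f \<in> ?B" by (auto intro: Hinf_boundI wnorm_le)
  define d where "d n = (\<lambda>z. \<phi> (r n) z - f z)" for n
  have d: "d n \<in> Hinf (radial v)" for n
    using Hinf_diff[OF radial_pos[OF v]] \<phi>(1) f by (simp add: d_def)
  have d_norm: "wnorm (radial v) (d n) \<le> 2" for n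
  proof (rule wnorm_le)
    show "d n holomorphic_on UNIV" using d by (simp add: Hinf_def)
    fix z
    have "cmod (d n z) \<le> 1 / radial v z + 1 / radial v z"
      using norm_triangle_ineq4[of "\<phi> (r n) z" "f z"] B_le[OF \<phi>(1), of "r n" z] B_le[OF f, of z]
      by (simp add: d_def)
    then show "radial v z * cmod (d n z) \<le> 2" using radial_pos[OF v, of z] by (simp add: field_simps)
  qed
  have \<sigma>Y: "\<sigma> n \<in> Y" and fY: "volterra g f \<in> Y" for n
    using volterra_in_H0[OF small] \<phi>(1)[of n] f Y(1) by (auto simp: \<phi>(2))
  have dist_eq: "norm_dist Y (wnorm (radial w)) (\<sigma> (r n)) (volterra g f) = wnorm (radial w) (volterra g (d n))"
    for n
    using volterra_in_H0[OF small] \<phi> f Y(1) g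
    by (auto simp: norm_dist_def d_def volterra_diff Hinf_def subset_iff)
  have "(\<lambda>n. wnorm (radial w) (volterra g (d n))) \<longlonglongrightarrow> 0"
  proof (rule tendstoI)
    fix \<epsilon> :: real assume "0 < \<epsilon>"
    obtain A K where AK: "0 < A" "0 < K"
      "\<And>f m. f \<in> Hinf (radial v) \<Longrightarrow> (\<And>z. cmod z \<le> A \<Longrightarrow> cmod (f z) \<le> m) \<Longrightarrow>
          wnorm (radial w) (volterra g f) \<le> K * m + \<epsilon> / 8 * wnorm (radial v) f"
      using volterra_estimate[OF small, of "\<epsilon> / 8"] \<open>0 < \<epsilon>\<close> by auto
    have "uniform_limit (cball 0 A) (\<phi> \<circ> r) f sequentially" by (rule fr(4)) simp
    then have "\<forall>\<^sub>F n in sequentially. \<forall>z\<in>cball 0 A. dist ((\<phi> \<circ> r) n z) (f z) < \<epsilon> / 2 / K"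
      using \<open>0 < \<epsilon>\<close> AK(2) by (intro uniform_limitD[OF \<open>uniform_limit (cball 0 A) (\<phi> \<circ> r) f sequentially\<close>]) auto
    then show "\<forall>\<^sub>F n in sequentially. dist (wnorm (radial w) (volterra g (d n))) 0 < \<epsilon>"
    proof eventually_elim
      case (elim n)
      have "wnorm (radial w) (volterra g (d n)) \<le> K * (\<epsilon> / 2 / K) + \<epsilon> / 8 * wnorm (radial v) (d n)"
        using elim by (intro AK(3)[OF d]) (force simp: d_def dist_norm intro: less_imp_le)
      also have "\<dots> \<le> K * (\<epsilon> / 2 / K) + \<epsilon> / 8 * 2"
        using d_norm[of n] \<open>0 < \<epsilon>\<close> by (intro add_left_mono mult_left_mono) auto
      also have "\<dots> < \<epsilon>" using AK(2) \<open>0 < \<epsilon>\<close> by simp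
      finally have "wnorm (radial w) (volterra g (d n)) < \<epsilon>" .
      moreover have "volterra g (d n) \<in> Hinf (radial w)"
        using volterra_in_H0[OF small d] Y by auto
      ultimately show ?case
        using wnorm_nonneg[OF radial_pos[OF weight]] by simp
    qed
  qed
  then have "limitin (Metric_space.mtopology Y (norm_dist Y (wnorm (radial w)))) (\<sigma> \<circ> r) (volterra g f) sequentially"
    unfolding Metric_space.limitin_metric_dist_null[OF M]
    using \<sigma>Y fY by (simp add: dist_eq)
  then show "\<exists>l r. l \<in> volterra g ` ?B \<and> strict_mono r \<and>
      limitin (Metric_space.mtopology Y (norm_dist Y (wnorm (radial w)))) (\<sigma> \<circ> r) l sequentially"
    using f fr(2) by blast
qed

section \<open>Necessity of the growth condition\<close>

text \<open>The monomial \<open>z\<^sup>n\<close> has larger degree than the polynomial.  That its image belongs to the large target space gives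
  \<open>z\<^sup>n g' = O(slope)\<close>, whence the product of the polynomial and \<open>g'\<close> is \<open>O(slope/|z|)\<close>.\<close>

lemma polynomial_volterra_H0:
  assumes T: "\<And>n a. volterra g (\<lambda>z. \<Sum>k<n. a k * z ^ k) \<in> Hinf (radial w)"
  shows "volterra g (\<lambda>z. \<Sum>k<n. a k * z ^ k) \<in> H0 (radial w)"
proof (rule slope_imp_H0[OF holomorphic_volterra[OF polynomial_holomorphic g]])
  fix \<epsilon> :: real assume "0 < \<epsilon>"
  have mon: "(\<lambda>z. \<Sum>k<Suc n. (if k = n then 1 else 0) * z ^ k) = (\<lambda>z::complex. z ^ n)"
    by (auto simp: fun_eq_iff)
  have F: "volterra g (\<lambda>z. z ^ n) \<in> Hinf (radial w)"
    using T[where n = "Suc n" and a = "\<lambda>k. if k = n then 1 else 0"] unfolding mon .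
  define M where "M = 2 * (1 + C) * exp 1 * wnorm (radial w) (volterra g (\<lambda>z. z ^ n))"
  have M0: "0 \<le> M" using wnorm_nonneg[OF radial_pos[OF weight] F] C_pos by (simp add: M_def)
  define S where "S = (\<Sum>k<n. cmod (a k))"
  have S0: "0 \<le> S" by (auto simp: S_def intro: sum_nonneg)
  have "\<forall>\<^sub>F r in at_top. max 1 (S * M / \<epsilon>) \<le> r" by (rule eventually_ge_at_top)
  from eventually_compose_filterlim[OF this filterlim_norm_at_top]
  have "\<forall>\<^sub>F z::complex in at_infinity. max 1 (S * M / \<epsilon>) \<le> cmod z" .
  with eventually_gt_R
  show "\<forall>\<^sub>F z in at_infinity.
      cmod (deriv (volterra g (\<lambda>z. \<Sum>k<n. a k * z ^ k)) z) \<le> \<epsilon> * slope (cmod z)"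
  proof eventually_elim
    case (elim z)
    then have z: "1 \<le> cmod z" "S * M / \<epsilon> \<le> cmod z" by auto
    have "cmod (\<Sum>k<n. a k * z ^ k) \<le> (\<Sum>k<n. cmod (a k) * (cmod z ^ n / cmod z))"
    proof (rule sum_norm_le)
      fix k assume "k \<in> {..<n}"
      then have "cmod z ^ k * cmod z \<le> cmod z ^ n"
        using power_increasing[of "Suc k" n "cmod z"] z by (simp add: mult.commute)
      moreover have "0 < cmod z" using z by linarith
      ultimately have "cmod z ^ k \<le> cmod z ^ n / cmod z" by (simp only: pos_le_divide_eq)
      then show "cmod (a k * z ^ k) \<le> cmod (a k) * (cmod z ^ n / cmod z)"
        by (simp only: norm_mult norm_power) (rule mult_left_mono, auto)
    qed
    also have "\<dots> = S / cmod z * cmod z ^ n" by (simp add: S_def sum_distrib_right sum_divide_distrib)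
    finally have p: "cmod (\<Sum>k<n. a k * z ^ k) \<le> S / cmod z * cmod z ^ n" .
    have "deriv (volterra g (\<lambda>z. z ^ n)) z = z ^ n * deriv g z"
      by (rule deriv_volterra[OF _ g]) (intro holomorphic_intros)
    then have zn: "cmod z ^ n * cmod (deriv g z) \<le> M * slope (cmod z)"
      using deriv_le_wnorm[OF F elim(1)] by (simp add: M_def norm_mult norm_power)
    have "cmod (deriv (volterra g (\<lambda>z. \<Sum>k<n. a k * z ^ k)) z)
        = cmod (\<Sum>k<n. a k * z ^ k) * cmod (deriv g z)"
      by (simp add: deriv_volterra[OF polynomial_holomorphic g] norm_mult)
    also have "\<dots> \<le> (S / cmod z * cmod z ^ n) * cmod (deriv g z)"
      using p by (intro mult_right_mono) auto
    also have "\<dots> = S / cmod z * (cmod z ^ n * cmod (deriv g z))" by (simp only: mult.assoc)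
    also have "\<dots> \<le> S / cmod z * (M * slope (cmod z))"
      using zn S0 z by (intro mult_left_mono) auto
    also have "\<dots> = (S * M / cmod z) * slope (cmod z)" by simp
    also have "\<dots> \<le> \<epsilon> * slope (cmod z)"
    proof (rule mult_right_mono)
      have "S * M \<le> \<epsilon> * cmod z" using z(2) \<open>0 < \<epsilon>\<close> by (simp add: pos_divide_le_eq mult.commute)
      moreover have "0 < cmod z" using z(1) by linarith
      ultimately show "S * M / cmod z \<le> \<epsilon>" by (simp only: pos_divide_le_eq)
      show "0 \<le> slope (cmod z)" using slope_pos[OF elim(1)] by simp
    qed
    finally show ?case .
  qed
qed

lemma not_small_symbolE:
  assumes "\<not> small_symbol"
  obtains \<epsilon> and y :: "nat \<Rightarrow> complex" where "0 < \<epsilon>" "discrete_seq y" "\<And>j. R < cmod (y j)"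
    "\<And>j. \<epsilon> * assoc_weight (radial v) (y j) * slope (cmod (y j)) < cmod (deriv g (y j))"
proof -
  let ?P = "\<lambda>\<epsilon> z. cmod (deriv g z) \<le> \<epsilon> * assoc_weight (radial v) z * slope (cmod z)"
  obtain \<epsilon> where \<epsilon>: "0 < \<epsilon>" "\<not> (\<forall>\<^sub>F z in at_infinity. ?P \<epsilon> z)"
    using assms by (auto simp: small_symbol_def)
  then have "\<forall>B. \<exists>z. B \<le> cmod z \<and> \<not> ?P \<epsilon> z" by (auto simp: eventually_at_infinity)
  then have "\<forall>j. \<exists>z. max (real j) (R + 1) \<le> cmod z \<and> \<not> ?P \<epsilon> z" by blast
  then obtain y where y: "\<And>j. max (real j) (R + 1) \<le> cmod (y j)" "\<And>j. \<not> ?P \<epsilon> (y j)" by metis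
  have "discrete_seq y"
    unfolding discrete_seq_def
  proof (rule filterlim_norm_at_top_imp_at_infinity, rule filterlim_at_top_mono[OF filterlim_real_sequentially])
    show "\<forall>\<^sub>F j in sequentially. real j \<le> cmod (y j)"
      using y(1) by (intro always_eventually allI) (meson max.bounded_iff)
  qed
  moreover have "R < cmod (y j)" for j using y(1)[of j] by simp
  ultimately show thesis using that[OF \<epsilon>(1)] y(2) by (meson not_le)
qed

text \<open>Suppose that \<open>|g'| > \<epsilon> a slope\<close> along a sequence \<open>y\<^sub>j\<close>, where \<open>a\<close> is the associated weight,
  and let \<open>p\<^sub>j\<close> be almost extremal polynomials at \<open>y\<^sub>j\<close>, so that \<open>|(V\<^sub>g p\<^sub>j)'| = |p\<^sub>j g'| > (\<epsilon>/8) slope\<close>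
  at \<open>y\<^sub>j\<close>.  Along a subsequence the images are Cauchy in norm, and hence so are their
  derivatives relative to the slope; but the derivative of one fixed image is \<open>o(slope)\<close>.\<close>

lemma compact_imp_small_symbol:
  assumes Y: "Y \<subseteq> Hinf (radial w)" and M: "Metric_space Y (norm_dist Y (wnorm (radial w)))"
    and K: "compactin (norm_topology Y (wnorm (radial w))) K"
    and TK: "\<And>n a. wnorm (radial v) (\<lambda>z. \<Sum>k<n. a k * z ^ k) \<le> 1 \<Longrightarrow>
        volterra g (\<lambda>z. \<Sum>k<n. a k * z ^ k) \<in> K"
    and TH0: "\<And>n a. volterra g (\<lambda>z. \<Sum>k<n. a k * z ^ k) \<in> H0 (radial w)"
  shows small_symbol
proof (rule ccontr)
  assume "\<not> small_symbol"
  obtain \<epsilon> y where \<epsilon>: "0 < \<epsilon>" and y: "discrete_seq y" "\<And>j. R < cmod (y j)"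
    "\<And>j. \<epsilon> * assoc_weight (radial v) (y j) * slope (cmod (y j)) < cmod (deriv g (y j))"
    using not_small_symbolE[OF \<open>\<not> small_symbol\<close>] by metis
  have "\<exists>p n a. p = (\<lambda>z. \<Sum>k<n. a k * z ^ k) \<and> wnorm (radial v) p \<le> 1 \<and>
      1 \<le> 8 * assoc_weight (radial v) (y j) * cmod (p (y j))" for j
    using polynomial_witness[OF v, of "y j"] by metis
  then obtain p where p: "\<And>j. \<exists>n a. p j = (\<lambda>z. \<Sum>k<n. a k * z ^ k)"
    "\<And>j. wnorm (radial v) (p j) \<le> 1" "\<And>j. 1 \<le> 8 * assoc_weight (radial v) (y j) * cmod (p j (y j))"
    by metis
  define \<sigma> where "\<sigma> j = volterra g (p j)" for j
  have \<sigma>K: "\<sigma> j \<in> K" and \<sigma>0: "\<sigma> j \<in> H0 (radial w)" and hol: "p j holomorphic_on UNIV" for j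
    using p(1)[of j] p(2)[of j] TK TH0 polynomial_holomorphic by (auto simp: \<sigma>_def)
  obtain l r where r: "strict_mono (r :: nat \<Rightarrow> nat)"
    and lim: "limitin (Metric_space.mtopology Y (norm_dist Y (wnorm (radial w)))) (\<sigma> \<circ> r) l sequentially"
    using K[unfolded norm_topology_def Metric_space.compactin_sequentially[OF M]] \<sigma>K by blast
  have KY: "K \<subseteq> Y"
    using K unfolding norm_topology_def Metric_space.compactin_sequentially[OF M] by blast
  have cauchy: "Metric_space.MCauchy Y (norm_dist Y (wnorm (radial w))) (\<sigma> \<circ> r)"
    using lim \<sigma>K KY by (intro Metric_space.convergent_imp_MCauchy[OF M]) auto
  define c where "c = 2 * (1 + C) * exp 1"
  have c: "0 < c" using C_pos by (simp add: c_def)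
  \<comment> \<open>Two contributions of \<open>\<epsilon>/16\<close> will contradict the lower bound \<open>\<epsilon>/8\<close>.\<close>
  have "0 < \<epsilon> / (16 * c)" using \<epsilon> c by simp
  then obtain N where N: "\<And>n n'. N \<le> n \<Longrightarrow> N \<le> n' \<Longrightarrow>
      norm_dist Y (wnorm (radial w)) ((\<sigma> \<circ> r) n) ((\<sigma> \<circ> r) n') < \<epsilon> / (16 * c)"
    using cauchy unfolding Metric_space.MCauchy_def[OF M] by blast
  have "filterlim (y \<circ> r) at_infinity sequentially"
    unfolding o_def by (rule filterlim_compose[OF y(1)[unfolded discrete_seq_def] filterlim_subseq[OF r]])
  moreover have "\<forall>\<^sub>F z in at_infinity. cmod (deriv (\<sigma> (r N)) z) \<le> \<epsilon> / 16 * slope (cmod z)"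
    by (rule deriv_H0[OF \<sigma>0]) (use \<epsilon> in simp)
  ultimately have "\<forall>\<^sub>F n in sequentially. cmod (deriv (\<sigma> (r N)) ((y \<circ> r) n)) \<le> \<epsilon> / 16 * slope (cmod ((y \<circ> r) n))"
    using eventually_compose_filterlim by blast
  then have "\<forall>\<^sub>F n in sequentially. N \<le> n \<and> cmod (deriv (\<sigma> (r N)) ((y \<circ> r) n)) \<le> \<epsilon> / 16 * slope (cmod ((y \<circ> r) n))"
    by (intro eventually_conj eventually_ge_at_top)
  then obtain n where n: "N \<le> n"
    "cmod (deriv (\<sigma> (r N)) (y (r n))) \<le> \<epsilon> / 16 * slope (cmod (y (r n)))"
    by (auto simp: eventually_sequentially)
  let ?z = "y (r n)" let ?s = "slope (cmod ?z)"
  let ?d = "\<lambda>z. \<sigma> (r n) z - \<sigma> (r N) z"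
  note sp = slope_pos[OF y(2), of "r n"]
  have s_hol: "\<sigma> j holomorphic_on UNIV" for j using \<sigma>0[of j] by (simp add: H0_def)
  have sY: "\<sigma> j \<in> Hinf (radial w)" for j using \<sigma>K KY Y by blast
  have dH: "?d \<in> Hinf (radial w)" by (rule Hinf_diff[OF radial_pos[OF weight] sY sY])
  have "wnorm (radial w) ?d \<le> \<epsilon> / (16 * c)"
    using N[OF n(1) order_refl] \<sigma>K KY by (auto simp: norm_dist_def subset_iff)
  then have "c * wnorm (radial w) ?d \<le> \<epsilon> / 16" using c by (simp add: pos_le_divide_eq mult_ac)
  then have "c * wnorm (radial w) ?d * ?s \<le> \<epsilon> / 16 * ?s" using sp by (intro mult_right_mono) auto
  then have "cmod (deriv ?d ?z) \<le> \<epsilon> / 16 * ?s"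
    using deriv_le_wnorm[OF dH y(2)[of "r n"]] by (simp add: c_def)
  then have "cmod (deriv (\<sigma> (r n)) ?z) \<le> \<epsilon> / 8 * ?s"
    using n(2) norm_triangle_ineq[of "deriv ?d ?z" "deriv (\<sigma> (r N)) ?z"]
    by (simp add: deriv_diff_entire s_hol)
  moreover have "cmod (deriv (\<sigma> (r n)) ?z) = cmod (p (r n) ?z) * cmod (deriv g ?z)"
    by (simp add: \<sigma>_def deriv_volterra[OF hol g] norm_mult)
  moreover have "\<epsilon> / 8 * ?s < cmod (p (r n) ?z) * cmod (deriv g ?z)"
  proof -
    have pp: "0 < cmod (p (r n) ?z)" using p(3)[of "r n"] by (cases "p (r n) ?z = 0") auto
    have "\<epsilon> / 8 * ?s * 1 \<le> \<epsilon> / 8 * ?s * (8 * assoc_weight (radial v) ?z * cmod (p (r n) ?z))"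
      using p(3)[of "r n"] \<epsilon> sp by (intro mult_left_mono) auto
    also have "\<dots> = cmod (p (r n) ?z) * (\<epsilon> * assoc_weight (radial v) ?z * ?s)" by simp
    also have "\<dots> < cmod (p (r n) ?z) * cmod (deriv g ?z)"
      using y(3)[of "r n"] pp by (intro mult_strict_left_mono)
    finally show ?thesis by simp
  qed
  ultimately show False by simp
qed

text \<open>Interpolating the reciprocals of the associated weight gives one function that is extremal, up to a
  constant, at all points of a subsequence simultaneously.  It belongs to \<open>Hinf (radial v)\<close> since the
  associated weight is at least \<open>v\<close>.\<close>

lemma interpolation_imp_large_volterra:
  assumes "\<not> small_symbol"
    and interp: "\<And>z. discrete_seq z \<Longrightarrow>
        \<exists>s :: nat \<Rightarrow> nat. strict_mono s \<and> interpolating (assoc_weight (radial v)) (z \<circ> s)"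
  obtains f \<eta> and y :: "nat \<Rightarrow> complex" where
    "f \<in> Hinf (radial v)" "wnorm (radial v) f \<le> 1 / 2" "0 < \<eta>" "discrete_seq y"
    "\<And>j. R < cmod (y j)" "\<And>j. \<eta> * slope (cmod (y j)) \<le> cmod (deriv (volterra g f) (y j))"
proof -
  obtain \<epsilon> y where \<epsilon>: "0 < \<epsilon>" and y: "discrete_seq y" "\<And>j. R < cmod (y j)"
    "\<And>j. \<epsilon> * assoc_weight (radial v) (y j) * slope (cmod (y j)) < cmod (deriv g (y j))"
    using not_small_symbolE[OF assms(1)] by metis
  obtain s where s: "strict_mono (s :: nat \<Rightarrow> nat)" "interpolating (assoc_weight (radial v)) (y \<circ> s)"
    using interp[OF y(1)] by blast
  let ?a = "assoc_weight (radial v)"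
  let ?\<alpha> = "\<lambda>j. complex_of_real (1 / ?a (y (s j)))"
  have "bdd_above (range (\<lambda>j. ?a ((y \<circ> s) j) * cmod (?\<alpha> j)))"
  proof -
    have "?a ((y \<circ> s) j) * cmod (?\<alpha> j) = 1" for j
      using assoc_weight_pos[OF v, of "y (s j)"] by (simp add: norm_divide)
    then show ?thesis by simp
  qed
  then obtain f0 where f0: "f0 \<in> Hinf ?a" "\<And>j. f0 (y (s j)) = ?\<alpha> j"
    using s(2) unfolding interpolating_def o_def by meson
  obtain B where B: "f0 holomorphic_on UNIV" "\<And>z. ?a z * cmod (f0 z) \<le> B"
    using f0(1) by (auto simp: Hinf_def bdd_above_def)
  have f0V: "f0 \<in> Hinf (radial v)"
  proof (rule Hinf_boundI[OF B(1)])
    fix z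
    show "radial v z * cmod (f0 z) \<le> B"
      using mult_right_mono[OF assoc_weight_ge[OF v, of z] norm_ge_zero[of "f0 z"]] B(2)[of z] by linarith
  qed
  let ?N = "wnorm (radial v) f0"
  have N: "0 \<le> ?N" by (rule wnorm_nonneg[OF radial_pos[OF v] f0V])
  \<comment> \<open>norm at most \<open>1/2\<close>, so that approximating polynomials have norm at most \<open>1\<close>\<close>
  define c where "c = 1 / (2 * (?N + 1))"
  have c: "0 < c" "c * ?N \<le> 1 / 2" using N by (auto simp: c_def field_simps)
  let ?f = "\<lambda>z. of_real c * f0 z"
  have f: "?f \<in> Hinf (radial v)" by (rule Hinf_cmult[OF radial_pos[OF v] f0V])
  show thesis
  proof (rule that[of ?f "c * \<epsilon>" "y \<circ> s"])
    show "?f \<in> Hinf (radial v)" by (rule f)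
    show "wnorm (radial v) ?f \<le> 1 / 2"
      using wnorm_cmult_le[OF radial_pos[OF v] f0V, of "of_real c"] c by simp
    show "0 < c * \<epsilon>" using c \<epsilon> by simp
    show "discrete_seq (y \<circ> s)"
      unfolding discrete_seq_def o_def
      by (rule filterlim_compose[OF y(1)[unfolded discrete_seq_def] filterlim_subseq[OF s(1)]])
    fix j
    show "R < cmod ((y \<circ> s) j)" using y(2) by simp
    let ?z = "y (s j)"
    have a: "0 < ?a ?z" by (rule assoc_weight_pos[OF v])
    have "cmod (deriv (volterra g ?f) ?z) = c / ?a ?z * cmod (deriv g ?z)"
      using f c a by (simp add: Hinf_def deriv_volterra g norm_mult norm_divide f0(2))
    moreover have "c / ?a ?z * (\<epsilon> * ?a ?z * slope (cmod ?z)) \<le> c / ?a ?z * cmod (deriv g ?z)"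
      using y(3)[of "s j"] c a by (intro mult_left_mono) auto
    ultimately show "c * \<epsilon> * slope (cmod ((y \<circ> s) j)) \<le> cmod (deriv (volterra g ?f) ((y \<circ> s) j))"
      using a by simp
  qed
qed

text \<open>The functional is the limit of \<open>F'(y\<^sub>j)/slope |y\<^sub>j|\<close> along a free ultrafilter, which exists and
  is bounded by \<open>deriv_le_wnorm\<close>, and vanishes on the small space by \<open>deriv_H0\<close>.\<close>

lemma exists_limit_functional:
  assumes y: "discrete_seq y" "\<And>j. R < cmod (y j)" and Y: "Y \<subseteq> Hinf (radial w)"
  obtains \<phi> where "\<phi> \<in> dual Y (wnorm (radial w))" "\<And>F. F \<in> H0 (radial w) \<Longrightarrow> \<phi> F = 0"
    "\<And>F \<eta>. F \<in> Y \<Longrightarrow> (\<And>j. \<eta> * slope (cmod (y j)) \<le> cmod (deriv F (y j))) \<Longrightarrow> \<eta> \<le> cmod (\<phi> F)"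
proof -
  obtain U :: "nat filter" where U: "U \<le> sequentially" "U \<noteq> bot"
    and Ulim: "\<forall>(x :: nat \<Rightarrow> complex) B. (\<forall>n. cmod (x n) \<le> B) \<longrightarrow> (\<exists>l. (x \<longlongrightarrow> l) U)"
    by (rule ultrafilter_limits)
  define L where "L F j = deriv F (y j) / of_real (slope (cmod (y j)))" for F j
  define \<phi> where "\<phi> F = Lim U (L F)" for F
  define c where "c = 2 * (1 + C) * exp 1"
  have sp: "0 < slope (cmod (y j))" for j by (rule slope_pos[OF y(2)])
  have hol: "F holomorphic_on UNIV" if "F \<in> Y" for F using that Y by (auto simp: Hinf_def)
  have norm_L: "cmod (L F j) = cmod (deriv F (y j)) / slope (cmod (y j))" for F j
    using sp[of j] by (simp add: L_def norm_divide)
  have L_le: "cmod (L F j) \<le> c * wnorm (radial w) F" if "F \<in> Y" for F j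
    using deriv_le_wnorm[OF _ y(2), of F j] that Y sp[of j]
    by (auto simp: norm_L pos_divide_le_eq c_def)
  have \<phi>_eqI: "\<phi> F = l" if "(L F \<longlongrightarrow> l) U" for F l
    unfolding \<phi>_def using U(2) that by (intro tendsto_Lim)
  have lim: "(L F \<longlongrightarrow> \<phi> F) U" if "F \<in> Y" for F
    using Ulim L_le[OF that] \<phi>_eqI by blast
  show thesis
  proof (rule that)
    show "\<phi> \<in> dual Y (wnorm (radial w))"
      unfolding dual_def
    proof (intro CollectI conjI ballI allI exI[of _ c])
      fix F G assume FG: "F \<in> Y" "G \<in> Y"
      have "L (\<lambda>z. F z + G z) = (\<lambda>j. L F j + L G j)"
        by (simp add: fun_eq_iff L_def deriv_add_entire hol FG add_divide_distrib)
      then show "\<phi> (\<lambda>z. F z + G z) = \<phi> F + \<phi> G"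
        using tendsto_add[OF lim lim] FG by (intro \<phi>_eqI) simp
    next
      fix a F assume F: "F \<in> Y"
      have "L (\<lambda>z. a * F z) = (\<lambda>j. a * L F j)"
        by (simp add: fun_eq_iff L_def deriv_cmult_entire hol F)
      then show "\<phi> (\<lambda>z. a * F z) = a * \<phi> F"
        using tendsto_mult_left[OF lim[OF F], of a] by (intro \<phi>_eqI) simp
    next
      fix F assume F: "F \<in> Y"
      show "cmod (\<phi> F) \<le> c * wnorm (radial w) F"
        by (rule Lim_norm_ubound[OF U(2) lim[OF F]]) (simp add: L_le[OF F])
    qed
    fix F assume F: "F \<in> H0 (radial w)"
    have "(L F \<longlongrightarrow> 0) U"
    proof (rule tendstoI)
      fix e :: real assume "0 < e"
      have "filterlim y at_infinity U"
        using y(1) U(1) unfolding discrete_seq_def by (rule filterlim_mono[OF _ order_refl])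
      from eventually_compose_filterlim[OF deriv_H0[OF F, of "e / 2"] this]
      have "\<forall>\<^sub>F j in U. cmod (deriv F (y j)) \<le> e / 2 * slope (cmod (y j))" using \<open>0 < e\<close> by simp
      then show "\<forall>\<^sub>F j in U. dist (L F j) 0 < e"
      proof eventually_elim
        case (elim j)
        then have "cmod (L F j) \<le> e / 2" using sp[of j] by (simp add: norm_L pos_divide_le_eq)
        then show ?case using \<open>0 < e\<close> by simp
      qed
    qed
    then show "\<phi> F = 0" by (rule \<phi>_eqI)
  next
    fix F \<eta> assume F: "F \<in> Y" and \<eta>: "\<And>j. \<eta> * slope (cmod (y j)) \<le> cmod (deriv F (y j))"
    show "\<eta> \<le> cmod (\<phi> F)"
    proof (rule tendsto_lowerbound[OF tendsto_norm[OF lim[OF F]] _ U(2)])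
      show "\<forall>\<^sub>F j in U. \<eta> \<le> cmod (L F j)"
        using \<eta> sp by (intro always_eventually allI) (simp add: norm_L pos_le_divide_eq)
    qed
  qed
qed

text \<open>The \<open>N\<close>-th polynomial is within \<open>1/(N + 1)\<close> of \<open>f\<close> on the disc of radius \<open>N\<close>; locally uniform
  convergence passes to the images.\<close>

lemma polynomial_sequence:
  assumes f: "f \<in> Hinf (radial v)" "wnorm (radial v) f \<le> 1 / 2"
  obtains p where "\<And>N. \<exists>n a. p N = (\<lambda>z. \<Sum>k<n. a k * z ^ k)" "\<And>N. wnorm (radial v) (p N) \<le> 1"
    "\<And>z. (\<lambda>N. volterra g (p N) z) \<longlonglongrightarrow> volterra g f z"
proof -
  have hol: "f holomorphic_on UNIV" using f by (simp add: Hinf_def)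
  have "\<exists>p n a. p = (\<lambda>z. \<Sum>k<n. a k * z ^ k) \<and> wnorm (radial v) p \<le> 1 \<and>
      (\<forall>z. cmod z \<le> real N \<longrightarrow> cmod (p z - f z) \<le> 1 / real (Suc N))" for N
  proof -
    obtain n a where p: "\<And>z. radial v z * cmod (\<Sum>k<n. a k * z ^ k) \<le> 2 * wnorm (radial v) f"
      "\<And>z. cmod z \<le> real N \<Longrightarrow> cmod ((\<Sum>k<n. a k * z ^ k) - f z) \<le> 1 / real (Suc N)"
      by (rule polynomial_approximation[OF v f(1), of "1 / real (Suc N)" "real N"])
        (simp, simp, rule that)
    have "wnorm (radial v) (\<lambda>z. \<Sum>k<n. a k * z ^ k) \<le> 1"
    proof (rule wnorm_le[OF polynomial_holomorphic])
      fix z show "radial v z * cmod (\<Sum>k<n. a k * z ^ k) \<le> 1" using p(1)[of z] f(2) by simp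
    qed
    with p(2) show ?thesis by blast
  qed
  then obtain p where p: "\<And>N. \<exists>n a. p N = (\<lambda>z. \<Sum>k<n. a k * z ^ k)" "\<And>N. wnorm (radial v) (p N) \<le> 1"
    "\<And>N z. cmod z \<le> real N \<Longrightarrow> cmod (p N z - f z) \<le> 1 / real (Suc N)"
    by metis
  have hol_p: "p N holomorphic_on UNIV" for N using p(1)[of N] polynomial_holomorphic by auto
  have "(\<lambda>N. volterra g (p N) z) \<longlonglongrightarrow> volterra g f z" for z
  proof -
    have "deriv g holomorphic_on UNIV" using g by (auto intro: holomorphic_deriv)
    from holomorphic_on_imp_continuous_on[OF holomorphic_on_subset[OF this subset_UNIV]]
    have "compact (deriv g ` cball 0 (cmod z))" by (intro compact_continuous_image) auto
    then obtain G where G: "0 < G" "\<And>\<zeta>. cmod \<zeta> \<le> cmod z \<Longrightarrow> cmod (deriv g \<zeta>) \<le> G"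
      by (auto dest!: compact_imp_bounded simp: bounded_pos)
    have "(\<lambda>N. volterra g (p N) z - volterra g f z) \<longlonglongrightarrow> 0"
    proof (rule Lim_null_comparison)
      show "(\<lambda>N. cmod z * (1 / real (Suc N) * G)) \<longlonglongrightarrow> 0"
        using tendsto_mult[OF tendsto_const[of "cmod z"] tendsto_mult[OF LIMSEQ_inverse_real_of_nat tendsto_const[of G]]]
        by (simp add: inverse_eq_divide)
      have "\<forall>\<^sub>F N in sequentially. nat \<lceil>cmod z\<rceil> \<le> N" by (rule eventually_ge_at_top)
      then show "\<forall>\<^sub>F N in sequentially. norm (volterra g (p N) z - volterra g f z) \<le> cmod z * (1 / real (Suc N) * G)"
      proof eventually_elim
        case (elim N)
        then have zN: "cmod z \<le> real N" by linarith
        have "cmod (volterra g (\<lambda>z. p N z - f z) z) \<le> cmod z * (1 / real (Suc N) * G)"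
        proof (rule volterra_le[OF _ g order_refl])
          show "(\<lambda>z. p N z - f z) holomorphic_on UNIV" by (intro holomorphic_intros hol hol_p)
          fix \<zeta> assume "cmod \<zeta> \<le> cmod z"
          then show "cmod ((p N \<zeta> - f \<zeta>) * deriv g \<zeta>) \<le> 1 / real (Suc N) * G"
            unfolding norm_mult using p(3)[of \<zeta> N] G zN by (intro mult_mono) auto
        qed
        then show ?case by (simp only: volterra_diff[OF hol_p hol g])
      qed
    qed
    then show ?thesis by (simp add: LIM_zero_iff)
  qed
  with p that show thesis by blast
qed

text \<open>If the condition failed, the function \<open>f\<close> from \<open>interpolation_imp_large_volterra\<close> would be a pointwise
  limit of polynomials \<open>p\<^sub>N\<close> in the unit ball.  The functionals \<open>\<phi>\<close> from \<open>exists_limit_functional\<close>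
  vanish at every \<open>V\<^sub>g p\<^sub>N\<close>, hence at their weak cluster point \<open>V\<^sub>g f\<close>, although
  \<open>|\<phi> (V\<^sub>g f)| \<ge> \<eta> > 0\<close>.\<close>

lemma weakly_compact_imp_small_symbol:
  assumes Y: "Y \<subseteq> Hinf (radial w)"
    and K: "compactin (weak_topology Y (wnorm (radial w))) K"
    and TK: "\<And>n a. wnorm (radial v) (\<lambda>z. \<Sum>k<n. a k * z ^ k) \<le> 1 \<Longrightarrow>
        volterra g (\<lambda>z. \<Sum>k<n. a k * z ^ k) \<in> K"
    and TH0: "\<And>n a. volterra g (\<lambda>z. \<Sum>k<n. a k * z ^ k) \<in> H0 (radial w)"
    and interp: "\<And>z. discrete_seq z \<Longrightarrow>
        \<exists>s :: nat \<Rightarrow> nat. strict_mono s \<and> interpolating (assoc_weight (radial v)) (z \<circ> s)"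
  shows small_symbol
proof (rule ccontr)
  assume ns: "\<not> small_symbol"
  obtain f \<eta> and y :: "nat \<Rightarrow> complex" where f: "f \<in> Hinf (radial v)" "wnorm (radial v) f \<le> 1 / 2"
    and \<eta>: "0 < \<eta>" and y: "discrete_seq y" "\<And>j. R < cmod (y j)"
    and large: "\<And>j. \<eta> * slope (cmod (y j)) \<le> cmod (deriv (volterra g f) (y j))"
    using interpolation_imp_large_volterra[OF ns interp] by metis
  obtain p where p: "\<And>N. \<exists>n a. p N = (\<lambda>z. \<Sum>k<n. a k * z ^ k)" "\<And>N. wnorm (radial v) (p N) \<le> 1"
    "\<And>z. (\<lambda>N. volterra g (p N) z) \<longlonglongrightarrow> volterra g f z"
    using polynomial_sequence[OF f] by metis
  have pK: "volterra g (p N) \<in> K" and p0: "volterra g (p N) \<in> H0 (radial w)" for N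
    using p(1)[of N] p(2)[of N] TK TH0 by auto
  obtain \<phi> where \<phi>: "\<phi> \<in> dual Y (wnorm (radial w))" "\<And>F. F \<in> H0 (radial w) \<Longrightarrow> \<phi> F = 0"
    "\<And>F \<eta>. F \<in> Y \<Longrightarrow> (\<And>j. \<eta> * slope (cmod (y j)) \<le> cmod (deriv F (y j))) \<Longrightarrow> \<eta> \<le> cmod (\<phi> F)"
    using exists_limit_functional[OF y Y] by metis
  note cluster = weak_cluster_point_pointwise[OF radial_pos[OF weight] Y K pK p(3)]
  have "\<phi> (volterra g f) = 0" by (rule cluster(2)[OF \<phi>(1)]) (rule \<phi>(2)[OF p0])
  moreover have "volterra g f \<in> Y" using cluster(1) compactin_subset_topspace[OF K] by auto
  ultimately show False using \<phi>(3)[OF _ large] \<eta> by simp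
qed

section \<open>The characterisation\<close>

text \<open>For both domain spaces the image of the unit ball is part of the compact set of
  \<open>compactin_volterra_ball\<close>, which is compact in the coarser weak topology as well.  Both topologies
  being Hausdorff, the closure of the image stays inside that set.\<close>

lemma small_symbol_imp_compact:
  assumes small: small_symbol and X: "X \<subseteq> Hinf (radial v)"
    and Y: "H0 (radial w) \<subseteq> Y" "Y \<subseteq> Hinf (radial w)"
    and minus: "\<And>f h. f \<in> Y \<Longrightarrow> h \<in> Y \<Longrightarrow> (\<lambda>z. f z - h z) \<in> Y"
  shows "compact_op (volterra g) X (wnorm (radial v)) Y (wnorm (radial w))"
    and "weakly_compact_op (volterra g) X (wnorm (radial v)) Y (wnorm (radial w))"
proof -
  let ?K = "volterra g ` {f \<in> Hinf (radial v). wnorm (radial v) f \<le> 1}"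
  have M: "Metric_space Y (norm_dist Y (wnorm (radial w)))"
    by (rule Metric_space_weighted[OF radial_pos[OF weight] Y(2) minus])
  note bop = volterra_bounded_op[OF small X Y(1)]
  note K = compactin_volterra_ball[OF small Y M]
  have sub: "volterra g ` {f \<in> X. wnorm (radial v) f \<le> 1} \<subseteq> ?K" using X by auto
  have "Hausdorff_space (norm_topology Y (wnorm (radial w)))"
    unfolding norm_topology_def by (rule Metric_space.Hausdorff_space_mtopology[OF M])
  from relatively_compactin_subset[OF this K sub] bop
  show "compact_op (volterra g) X (wnorm (radial v)) Y (wnorm (radial w))"
    by (simp add: compact_op_def)
  have haus: "Hausdorff_space (weak_topology Y (wnorm (radial w)))"
  proof (rule Hausdorff_weak_topology)
    fix f h :: "complex \<Rightarrow> complex" assume "f \<noteq> h"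
    then obtain z where "f z \<noteq> h z" by blast
    then show "\<exists>\<phi>\<in>dual Y (wnorm (radial w)). \<phi> f \<noteq> \<phi> h"
      by (intro bexI[of _ "\<lambda>f. f z"] point_evaluation_dual[OF radial_pos[OF weight] Y(2)])
  qed
  have "compactin (weak_topology Y (wnorm (radial w))) ?K"
    by (rule norm_compactin_imp_weak_compactin[OF M minus K])
  from relatively_compactin_subset[OF haus this sub]
  show "weakly_compact_op (volterra g) X (wnorm (radial v)) Y (wnorm (radial w))"
    unfolding weakly_compact_op_def by (rule conjI[OF bop])
qed

text \<open>The inclusions on \<open>X\<close> and \<open>Y\<close> here and below cover the pair of large spaces and the pair of small
  spaces at once.\<close>

lemma bounded_op_polynomial_volterra:
  assumes X: "H0 (radial v) \<subseteq> X" and Y: "Y \<subseteq> Hinf (radial w)"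
    and T: "bounded_op (volterra g) X (wnorm (radial v)) Y (wnorm (radial w))"
  shows "volterra g (\<lambda>z. \<Sum>k<n. a k * z ^ k) \<in> H0 (radial w)"
proof (rule polynomial_volterra_H0)
  fix n and a :: "nat \<Rightarrow> complex"
  have "(\<lambda>z. \<Sum>k<n. a k * z ^ k) \<in> X" using polynomial_in_H0[OF v] X by blast
  moreover have "volterra g ` X \<subseteq> Y" using T by (simp add: bounded_op_def)
  ultimately show "volterra g (\<lambda>z. \<Sum>k<n. a k * z ^ k) \<in> Hinf (radial w)" using Y by blast
qed

lemma compact_op_imp_small_symbol:
  assumes X: "H0 (radial v) \<subseteq> X" and Y: "Y \<subseteq> Hinf (radial w)"
    and minus: "\<And>f h. f \<in> Y \<Longrightarrow> h \<in> Y \<Longrightarrow> (\<lambda>z. f z - h z) \<in> Y"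
    and T: "compact_op (volterra g) X (wnorm (radial v)) Y (wnorm (radial w))"
  shows small_symbol
proof -
  have rc: "relatively_compactin (norm_topology Y (wnorm (radial w)))
      (volterra g ` {f \<in> X. wnorm (radial v) f \<le> 1})"
    and b: "bounded_op (volterra g) X (wnorm (radial v)) Y (wnorm (radial w))"
    using T by (auto simp: compact_op_def)
  have M: "Metric_space Y (norm_dist Y (wnorm (radial w)))"
    by (rule Metric_space_weighted[OF radial_pos[OF weight] Y minus])
  show ?thesis
  proof (rule compact_imp_small_symbol[OF Y M subset_closure_of_relatively_compactin(1)[OF rc]])
    fix n and a :: "nat \<Rightarrow> complex"
    assume "wnorm (radial v) (\<lambda>z. \<Sum>k<n. a k * z ^ k) \<le> 1"
    then show "volterra g (\<lambda>z. \<Sum>k<n. a k * z ^ k) \<in> norm_topology Y (wnorm (radial w)) closure_of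
        (volterra g ` {f \<in> X. wnorm (radial v) f \<le> 1})"
      using subset_closure_of_relatively_compactin(2)[OF rc] polynomial_in_H0[OF v] X by blast
  qed (rule bounded_op_polynomial_volterra[OF X Y b])
qed

lemma weakly_compact_op_imp_small_symbol:
  assumes X: "H0 (radial v) \<subseteq> X" and Y: "Y \<subseteq> Hinf (radial w)"
    and T: "weakly_compact_op (volterra g) X (wnorm (radial v)) Y (wnorm (radial w))"
    and interp: "\<And>z. discrete_seq z \<Longrightarrow>
        \<exists>s :: nat \<Rightarrow> nat. strict_mono s \<and> interpolating (assoc_weight (radial v)) (z \<circ> s)"
  shows small_symbol
proof -
  have rc: "relatively_compactin (weak_topology Y (wnorm (radial w)))
      (volterra g ` {f \<in> X. wnorm (radial v) f \<le> 1})"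
    and b: "bounded_op (volterra g) X (wnorm (radial v)) Y (wnorm (radial w))"
    using T by (auto simp: weakly_compact_op_def)
  show ?thesis
  proof (rule weakly_compact_imp_small_symbol[OF Y subset_closure_of_relatively_compactin(1)[OF rc]])
    fix n and a :: "nat \<Rightarrow> complex"
    assume "wnorm (radial v) (\<lambda>z. \<Sum>k<n. a k * z ^ k) \<le> 1"
    then show "volterra g (\<lambda>z. \<Sum>k<n. a k * z ^ k) \<in> weak_topology Y (wnorm (radial w)) closure_of
        (volterra g ` {f \<in> X. wnorm (radial v) f \<le> 1})"
      using subset_closure_of_relatively_compactin(2)[OF rc] polynomial_in_H0[OF v] X by blast
  qed (rule bounded_op_polynomial_volterra[OF X Y b] interp, assumption?)+
qed

end

theorem theorem3p7:
  fixes v w :: "real \<Rightarrow> real" and R C \<delta> :: real and g :: "complex \<Rightarrow> complex"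
  assumes "is_weight v" and "is_weight w"
    and "R > 0" and "C > 0" and "0 < \<delta>" and "\<delta> \<le> 1"
    and "w C1_differentiable_on {R<..}" and "deriv w C1_differentiable_on {R<..}"
    and "antimono_on {R<..} (\<lambda>r. \<bar>deriv w r\<bar> * r powr (1 + \<delta>))"
    and "\<forall>r>R. - (w r * deriv (deriv w) r / (deriv w r)\<^sup>2) \<le> C"
    and "g holomorphic_on UNIV"
  shows
    "let V = radial v; W = radial w; T = volterra g;
         c1 = compact_op T (Hinf V) (wnorm V) (Hinf W) (wnorm W);
         c2 = compact_op T (H0 V) (wnorm V) (H0 W) (wnorm W);
         c3 = ((\<lambda>z. (W z)\<^sup>2 * cmod (deriv g z) / (radial (deriv w) z * assoc_weight V z))
                 \<longlongrightarrow> 0) at_infinity;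
         c4 = weakly_compact_op T (Hinf V) (wnorm V) (Hinf W) (wnorm W);
         c5 = weakly_compact_op T (H0 V) (wnorm V) (H0 W) (wnorm W)
     in (c1 \<longleftrightarrow> c2) \<and> (c2 \<longleftrightarrow> c3) \<and>
        ((\<forall>z. discrete_seq z \<longrightarrow>
            (\<exists>s :: nat \<Rightarrow> nat. strict_mono s \<and> interpolating (assoc_weight V) (z \<circ> s)))
          \<longrightarrow> (c3 \<longleftrightarrow> c4) \<and> (c4 \<longleftrightarrow> c5))"
proof -
  have der: "(f has_real_derivative deriv f r) (at r)"
    if "f C1_differentiable_on {R<..}" "R < r" for f r
  proof -
    have "f differentiable at r" using that by (auto simp: C1_differentiable_on_eq)
    then show ?thesis by (auto simp: real_differentiable_def dest: DERIV_imp_deriv)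
  qed
  interpret volterra_weights w R C v g
  proof
    show "deriv w r < 0" if "R < r" for r
      using weight_deriv_neg[OF assms(2,3) der[OF assms(7)] assms(9) that] .
  qed (use assms der in auto)
  note HV = H0_subset_Hinf[OF v] and HW = H0_subset_Hinf[OF weight]
  note dI = Hinf_diff[OF radial_pos[OF weight]] and d0 = H0_diff[OF radial_pos[OF weight]]
  let ?V = "radial v" and ?W = "radial w"
  have c1: "compact_op (volterra g) (Hinf ?V) (wnorm ?V) (Hinf ?W) (wnorm ?W) \<longleftrightarrow> small_symbol"
    using compact_op_imp_small_symbol[OF HV order_refl dI]
      small_symbol_imp_compact(1)[OF _ order_refl HW order_refl dI] by blast
  have c2: "compact_op (volterra g) (H0 ?V) (wnorm ?V) (H0 ?W) (wnorm ?W) \<longleftrightarrow> small_symbol"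
    using compact_op_imp_small_symbol[OF order_refl HW d0]
      small_symbol_imp_compact(1)[OF _ HV order_refl HW d0] by blast
  have "weakly_compact_op (volterra g) (Hinf ?V) (wnorm ?V) (Hinf ?W) (wnorm ?W) \<longleftrightarrow> small_symbol"
    "weakly_compact_op (volterra g) (H0 ?V) (wnorm ?V) (H0 ?W) (wnorm ?W) \<longleftrightarrow> small_symbol"
    if "\<forall>z. discrete_seq z \<longrightarrow>
        (\<exists>s :: nat \<Rightarrow> nat. strict_mono s \<and> interpolating (assoc_weight ?V) (z \<circ> s))"
    using weakly_compact_op_imp_small_symbol[OF HV order_refl]
      weakly_compact_op_imp_small_symbol[OF order_refl HW] that
      small_symbol_imp_compact(2)[OF _ order_refl HW order_refl dI]
      small_symbol_imp_compact(2)[OF _ HV order_refl HW d0] by blast+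
  with c1 c2 show ?thesis
    unfolding Let_def small_symbol_iff by blast
qed

end
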